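(* Let $\mathbf{A}$ be a strongly Fregean algebra and let $a,b\in A$. Then $M(\Theta_{\mathbf{A}}(a,b))\in\mathcal{H}(\mathbf{A})$.
   Context: Conventions. $\mathsf{Con}(\mathbf{A})$ is the congruence lattice of an algebra $\mathbf{A}$ (congruences are subsets of $A^2$). $\mathsf{Cm}(\mathbf{A})$ is the set of completely meet irreducible congruences; for $\eta\in\mathsf{Cm}(\mathbf{A})$, $\eta^{+}$ denotes the least congruence strictly greater than $\eta$. For $\alpha\le\beta$ in $\mathsf{Con}(\mathbf{A})$ let $I[\alpha,\beta]=\{\gamma:\alpha\le\gamma\le\beta\}$. Write $I[\alpha,\beta]\nearrow I[\gamma,\delta]$ (equivalently $I[\gamma,\delta]\searrow I[\alpha,\beta]$) if $\beta\wedge\gamma=\alpha$ and $\beta\vee\gamma=\delta$. Two intervals are projective if they are connected by a finite sequence of steps $\nearrow,\searrow$. When $\mathsf{Con}(\mathbf{A})$ is modular, for $\varphi,\psi\in\mathsf{Cm}(\mathbf{A})$ put $\varphi\sim\psi$ iff $I[\varphi,\varphi^{+}]$ and $I[\psi,\psi^{+}]$ are projective; this is an equivalence relation. The language contains a distinguished constant term $1$. $\Theta_{\mathbf{A}}(c,d)$ is the least congruence containing $(c,d)$. $\mathbf{A}$ is congruence orderable if $\Theta_{\mathbf{A}}(1,a)=\Theta_{\mathbf{A}}(1,b)$ implies $a=b$ for $a,b\in A$; it is $1$-regular if $1/\alpha=1/\beta$ implies $\alpha=\beta$ for $\alpha,\beta\in\mathsf{Con}(\mathbf{A})$; it is Fregean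 if it is both. $\mathbf{A}$ is strongly Fregean if every homomorphic image of $\mathbf{A}$ is Fregean (with respect to $1$) and the variety generated by $\mathbf{A}$ is congruence modular. For strongly Fregean $\mathbf{A}$, $\varphi\sim\psi$ implies $\varphi^{+}=\psi^{+}$. For $U=\eta/\!\sim$ and $S\subset U$ put $\overline{S}:=S\cup\{\eta^{+}\}$ (independent of the choice of $\eta\in U$), and for $\varphi,\psi\in\overline{U}$ put $\varphi\bullet\psi:=(\varphi\div\psi)'\cap\eta^{+}$, where $\div$ is symmetric difference and $'$ is complement in $A^2$. Then $(\overline{U},\bullet)$ is a Boolean group (every element is its own inverse) with unit $\eta^{+}$, regarded as a vector space over $\mathbb{Z}_2$; "hyperplane" means a subspace of codimension $1$ (a maximal proper subgroup). For $\varphi\in\mathsf{Con}(\mathbf{A})$, $M(\varphi):=\{\mu\in\mathsf{Cm}(\mathbf{A}):\varphi\le\mu\}$. For $U=\eta/\!\sim$ put $U^{+}:=\{\vartheta\in\mathsf{Cm}(\mathbf{A}):\vartheta\ge\eta^{+}\}$. A set $Z\subset\mathsf{Cm}(\mathbf{A})$ is hereditary if (I) $Z$ is upward closed in $(\mathsf{Cm}(\mathbf{A}),\le)$, and (II) for all $U\in\mathsf{Cm}(\mathbf{A})/\!\sim$, if $U^{+}\subset Z$, then $\overline{Z\cap U}=\overline{U}$ or $\overline{Z\cap U}$ is a hyperplane in $(\overline{U},\bullet)$. $\mathcal{H}(\mathbf{A})$ is the set of all hereditary subsets of $\mathsf{Cm}(\mathbf{A})$. *)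

theory Defs
  imports "HOL-Algebra.Group"
begin

section \<open>Algebras, terms and varieties\<close>

text \<open>The similarity type is the type \<^typ>\<open>'f\<close> of operation symbols together with the field
  \<open>arity\<close>; \<open>opn A f\<close> is only meaningful on lists over the carrier of length \<open>arity A f\<close>.\<close>

record ('a, 'f) ualg = "'a partial_object" +
  arity :: "'f \<Rightarrow> nat"
  opn :: "'f \<Rightarrow> 'a list \<Rightarrow> 'a"

definition universal_algebra :: "('a, 'f) ualg \<Rightarrow> bool" where
  "universal_algebra A \<longleftrightarrow> carrier A \<noteq> {} \<and>
     (\<forall>f xs. length xs = arity A f \<and> set xs \<subseteq> carrier A \<longrightarrow> opn A f xs \<in> carrier A)"

datatype ('f, 'v) trm = Var 'v | App 'f "('f, 'v) trm list"

fun wf_trm :: "('f \<Rightarrow> nat) \<Rightarrow> ('f, 'v) trm \<Rightarrow> bool" where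
  "wf_trm ar (Var x) \<longleftrightarrow> True"
| "wf_trm ar (App f ts) \<longleftrightarrow> length ts = ar f \<and> (\<forall>t\<in>set ts. wf_trm ar t)"

fun eval_trm :: "('a, 'f) ualg \<Rightarrow> ('v \<Rightarrow> 'a) \<Rightarrow> ('f, 'v) trm \<Rightarrow> 'a" where
  "eval_trm A v (Var x) = v x"
| "eval_trm A v (App f ts) = opn A f (map (eval_trm A v) ts)"

definition satisfies :: "('a, 'f) ualg \<Rightarrow> ('f, nat) trm \<Rightarrow> ('f, nat) trm \<Rightarrow> bool" where
  "satisfies A s t \<longleftrightarrow> (\<forall>v \<in> UNIV \<rightarrow> carrier A. eval_trm A v s = eval_trm A v t)"

text \<open>A variety is an equationally defined class, so the variety generated by \<open>A\<close> consists of the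
  algebras of the same type satisfying every identity of \<open>A\<close>.\<close>

definition in_generated_variety :: "('a, 'f) ualg \<Rightarrow> ('b, 'f) ualg \<Rightarrow> bool" where
  "in_generated_variety A B \<longleftrightarrow> universal_algebra B \<and> arity B = arity A \<and>
     (\<forall>s t. wf_trm (arity A) s \<and> wf_trm (arity A) t \<and> satisfies A s t \<longrightarrow> satisfies B s t)"

text \<open>A constant term may contain variables as long as its value does not depend on them; for
  instance \<open>x \<leftrightarrow> x\<close> is the constant term \<open>1\<close> of equivalential algebras, whose type has no nullary
  symbol. Closed terms are a special case.\<close>

definition constant_term :: "('a, 'f) ualg \<Rightarrow> ('f, nat) trm \<Rightarrow> bool" where
  "constant_term A t \<longleftrightarrow> wf_trm (arity A) t \<and>
     (\<forall>v \<in> UNIV \<rightarrow> carrier A. \<forall>w \<in> UNIV \<rightarrow> carrier A. eval_trm A v t = eval_trm A w t)"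

definition const_value :: "('a, 'f) ualg \<Rightarrow> ('f, nat) trm \<Rightarrow> 'a" where
  "const_value A t = (THE c. \<forall>v \<in> UNIV \<rightarrow> carrier A. eval_trm A v t = c)"

definition alg_hom :: "('a, 'f) ualg \<Rightarrow> ('b, 'f) ualg \<Rightarrow> ('a \<Rightarrow> 'b) \<Rightarrow> bool" where
  "alg_hom A B h \<longleftrightarrow> h \<in> carrier A \<rightarrow> carrier B \<and>
     (\<forall>f xs. length xs = arity A f \<and> set xs \<subseteq> carrier A \<longrightarrow>
        h (opn A f xs) = opn B f (map h xs))"

definition homomorphic_image :: "('a, 'f) ualg \<Rightarrow> ('b, 'f) ualg \<Rightarrow> bool" where
  "homomorphic_image A B \<longleftrightarrow> universal_algebra B \<and> arity B = arity A \<and>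
     (\<exists>h. alg_hom A B h \<and> h ` carrier A = carrier B)"


section \<open>Congruences\<close>

definition Con :: "('a, 'f) ualg \<Rightarrow> 'a rel set" where
  "Con A = {\<theta>. equiv (carrier A) \<theta> \<and>
     (\<forall>f xs ys. length xs = arity A f \<and> list_all2 (\<lambda>x y. (x, y) \<in> \<theta>) xs ys \<longrightarrow>
        (opn A f xs, opn A f ys) \<in> \<theta>)}"

text \<open>Below, \<open>LEAST\<close> refers to the inclusion order. Meets in \<open>Con A\<close> are intersections.\<close>

definition Cg :: "('a, 'f) ualg \<Rightarrow> 'a \<Rightarrow> 'a \<Rightarrow> 'a rel" where
  "Cg A c d = (LEAST \<theta>. \<theta> \<in> Con A \<and> (c, d) \<in> \<theta>)"

definition Con_join :: "('a, 'f) ualg \<Rightarrow> 'a rel \<Rightarrow> 'a rel \<Rightarrow> 'a rel" where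
  "Con_join A \<alpha> \<beta> = (LEAST \<theta>. \<theta> \<in> Con A \<and> \<alpha> \<subseteq> \<theta> \<and> \<beta> \<subseteq> \<theta>)"

definition congruence_modular :: "('a, 'f) ualg \<Rightarrow> bool" where
  "congruence_modular A \<longleftrightarrow>
     (\<forall>\<alpha>\<in>Con A. \<forall>\<beta>\<in>Con A. \<forall>\<gamma>\<in>Con A. \<alpha> \<subseteq> \<gamma> \<longrightarrow>
        Con_join A \<alpha> (\<beta> \<inter> \<gamma>) = Con_join A \<alpha> \<beta> \<inter> \<gamma>)"

text \<open>A definition cannot quantify over algebras on all types, so the members of the generated
  variety range over one fixed large type. It contains isomorphic copies of all members whose
  cardinality is at most \<open>max(|'a|, |'f|, \<aleph>\<^sub>0)\<close>, in particular of \<open>A\<close>, of its finite powers and of the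
  free algebra on countably many generators. By Day's theorem (a variety is congruence modular iff
  its free algebra on four generators is) this is the same as quantifying over all members.\<close>

definition generates_modular_variety :: "('a, 'f) ualg \<Rightarrow> bool" where
  "generates_modular_variety A \<longleftrightarrow>
     (\<forall>B :: (('f, 'a + nat) trm set, 'f) ualg. in_generated_variety A B \<longrightarrow> congruence_modular B)"

definition Cm :: "('a, 'f) ualg \<Rightarrow> 'a rel set" where
  "Cm A = {\<eta> \<in> Con A. \<forall>S \<subseteq> Con A. carrier A \<times> carrier A \<inter> \<Inter> S = \<eta> \<longrightarrow> \<eta> \<in> S}"
  \<comment> \<open>the factor \<open>carrier A \<times> carrier A\<close> makes the empty meet the top congruence\<close>

definition cover :: "('a, 'f) ualg \<Rightarrow> 'a rel \<Rightarrow> 'a rel" where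
  "cover A \<eta> = (LEAST \<theta>. \<theta> \<in> Con A \<and> \<eta> \<subset> \<theta>)"

text \<open>The interval \<open>I[\<alpha>,\<beta>]\<close> is represented by the pair \<open>(\<alpha>, \<beta>)\<close>.\<close>

definition transposes_up :: "('a, 'f) ualg \<Rightarrow> ('a rel \<times> 'a rel) rel" where
  "transposes_up A = {((\<alpha>, \<beta>), (\<gamma>, \<delta>)) | \<alpha> \<beta> \<gamma> \<delta>.
     {\<alpha>, \<beta>, \<gamma>, \<delta>} \<subseteq> Con A \<and> \<alpha> \<subseteq> \<beta> \<and> \<gamma> \<subseteq> \<delta> \<and> \<beta> \<inter> \<gamma> = \<alpha> \<and> Con_join A \<beta> \<gamma> = \<delta>}"

definition projective :: "('a, 'f) ualg \<Rightarrow> ('a rel \<times> 'a rel) rel" where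
  "projective A = (transposes_up A \<union> (transposes_up A)\<inverse>)\<^sup>*"

definition Cm_sim :: "('a, 'f) ualg \<Rightarrow> 'a rel rel" where
  "Cm_sim A = {(\<phi>, \<psi>). \<phi> \<in> Cm A \<and> \<psi> \<in> Cm A \<and>
     ((\<phi>, cover A \<phi>), (\<psi>, cover A \<psi>)) \<in> projective A}"


section \<open>Fregean algebras\<close>

text \<open>The second argument is the element named by the constant term.\<close>

definition congruence_orderable :: "('a, 'f) ualg \<Rightarrow> 'a \<Rightarrow> bool" where
  "congruence_orderable A e \<longleftrightarrow>
     (\<forall>a\<in>carrier A. \<forall>b\<in>carrier A. Cg A e a = Cg A e b \<longrightarrow> a = b)"

definition point_regular :: "('a, 'f) ualg \<Rightarrow> 'a \<Rightarrow> bool" where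
  "point_regular A e \<longleftrightarrow> (\<forall>\<alpha>\<in>Con A. \<forall>\<beta>\<in>Con A. \<alpha> `` {e} = \<beta> `` {e} \<longrightarrow> \<alpha> = \<beta>)"

definition fregean :: "('a, 'f) ualg \<Rightarrow> ('f, nat) trm \<Rightarrow> bool" where
  "fregean A t \<longleftrightarrow>
     congruence_orderable A (const_value A t) \<and> point_regular A (const_value A t)"

text \<open>Homomorphic images range over algebras on \<^typ>\<open>'a set\<close>; this type carries the quotients
  \<open>A/\<theta>\<close>, hence every homomorphic image up to isomorphism.\<close>

definition strongly_fregean :: "('a, 'f) ualg \<Rightarrow> ('f, nat) trm \<Rightarrow> bool" where
  "strongly_fregean A t \<longleftrightarrow> universal_algebra A \<and> constant_term A t \<and>
     (\<forall>B :: ('a set, 'f) ualg. homomorphic_image A B \<longrightarrow> fregean B t) \<and>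
     generates_modular_variety A"


section \<open>Hereditary sets\<close>

definition M :: "('a, 'f) ualg \<Rightarrow> 'a rel \<Rightarrow> 'a rel set" where
  "M A \<phi> = {\<mu> \<in> Cm A. \<phi> \<subseteq> \<mu>}"

text \<open>In the following, \<open>\<eta>\<close> is a representative of the class \<open>U = \<eta>/\<sim>\<close>; it enters only through
  \<open>\<eta>\<^sup>+\<close>, which does not depend on its choice when \<open>A\<close> is strongly Fregean.\<close>

definition bar :: "('a, 'f) ualg \<Rightarrow> 'a rel \<Rightarrow> 'a rel set \<Rightarrow> 'a rel set" where
  "bar A \<eta> S = S \<union> {cover A \<eta>}"

definition bullet :: "('a, 'f) ualg \<Rightarrow> 'a rel \<Rightarrow> 'a rel \<Rightarrow> 'a rel \<Rightarrow> 'a rel" where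
  "bullet A \<eta> \<phi> \<psi> = (carrier A \<times> carrier A - sym_diff \<phi> \<psi>) \<inter> cover A \<eta>"

definition bar_group :: "('a, 'f) ualg \<Rightarrow> 'a rel \<Rightarrow> 'a rel set \<Rightarrow> 'a rel monoid" where
  "bar_group A \<eta> U = \<lparr>carrier = bar A \<eta> U, mult = bullet A \<eta>, one = cover A \<eta>\<rparr>"

text \<open>The subspaces of a vector space over the two-element field are its subgroups, so hyperplanes
  are the maximal proper subgroups.\<close>

definition hyperplane :: "'g set \<Rightarrow> 'g monoid \<Rightarrow> bool" where
  "hyperplane H G \<longleftrightarrow> subgroup H G \<and> H \<noteq> carrier G \<and>
     (\<forall>K. subgroup K G \<and> H \<subseteq> K \<longrightarrow> K = H \<or> K = carrier G)"

definition upper :: "('a, 'f) ualg \<Rightarrow> 'a rel \<Rightarrow> 'a rel set" where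
  "upper A \<eta> = {\<theta> \<in> Cm A. cover A \<eta> \<subseteq> \<theta>}"

definition hereditary :: "('a, 'f) ualg \<Rightarrow> 'a rel set \<Rightarrow> bool" where
  "hereditary A Z \<longleftrightarrow> Z \<subseteq> Cm A \<and>
     (\<forall>\<phi>\<in>Z. \<forall>\<psi>\<in>Cm A. \<phi> \<subseteq> \<psi> \<longrightarrow> \<psi> \<in> Z) \<and>
     (\<forall>U \<in> Cm A // Cm_sim A. \<forall>\<eta>\<in>U. upper A \<eta> \<subseteq> Z \<longrightarrow>
        bar A \<eta> (Z \<inter> U) = bar A \<eta> U \<or> hyperplane (bar A \<eta> (Z \<inter> U)) (bar_group A \<eta> U))"

definition hereditary_sets :: "('a, 'f) ualg \<Rightarrow> 'a rel set set" where
  "hereditary_sets A = {Z. hereditary A Z}"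

end

theory Submission
  imports Defs "HOL-Library.Countable"
begin

text \<open>
  Let \<open>Z\<close> be the set of completely meet irreducible congruences that contain \<open>(a, b)\<close>; it is upward
  closed. Let \<open>U\<close> be a projectivity class, with common cover \<open>\<eta>\<^sup>+\<close>, such that all completely meet
  irreducible congruences above \<open>\<eta>\<^sup>+\<close> are in \<open>Z\<close>. Every congruence is the meet of the completely
  meet irreducible ones above it, so \<open>(a, b) \<in> \<eta>\<^sup>+\<close>. For pairs in \<open>\<eta>\<^sup>+\<close>, membership in \<open>\<phi> \<bullet> \<psi>\<close> means membership in both or in neither of
  \<open>\<phi>\<close> and \<open>\<psi>\<close>. Hence \<open>\<phi> \<mapsto> ((a, b) \<in> \<phi>)\<close> is a homomorphism from the Boolean group \<open>U \<union> {\<eta>\<^sup>+}\<close> to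
  the group of two elements. Its kernel is \<open>(Z \<inter> U) \<union> {\<eta>\<^sup>+}\<close>, which is therefore the whole group or a
  hyperplane (\<open>hyperplane_of_pair\<close>).

  The substance is that \<open>U \<union> {\<eta>\<^sup>+}\<close> is a group at all: the cover is the same throughout \<open>U\<close>, and
  \<open>\<phi> \<bullet> \<psi>\<close> belongs to \<open>U\<close> for distinct \<open>\<phi>\<close> and \<open>\<psi>\<close> in \<open>U\<close>. Orderability of \<open>A/\<phi>\<close> shows that \<open>\<phi>\<close> differs
  from \<open>\<phi>\<^sup>+\<close> only by splitting the class of \<open>1\<close> into two halves (\<open>cover_iff\<close>). A projectivity between
  \<open>I[\<phi>, \<phi>\<^sup>+]\<close> and \<open>I[\<psi>, \<psi>\<^sup>+]\<close> can be broken into steps between completely meet irreducible congruences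
  whose intervals are transposes of one interval \<open>I[\<alpha>, \<beta>]\<close> below both (\<open>projective_similar\<close>). Two
  properties are transported by such a step. A translation collapses the two halves of \<open>\<phi>\<close> if and
  only if it collapses those of \<open>\<psi>\<close>; this is decided by any pair in \<open>\<beta>\<close> outside \<open>\<alpha>\<close>, and it makes
  \<open>\<phi> \<bullet> \<psi>\<close> a congruence. Moreover \<open>\<phi>\<^sup>+ = \<psi>\<^sup>+\<close> (\<open>cover_le_of_common_transpose\<close>): \<open>\<beta>\<close> meets \<open>\<phi>\<close> and \<open>\<psi>\<close>
  in \<open>\<alpha>\<close>, so it is centralized modulo \<open>\<alpha>\<close> by both, and if the covers differed, \<open>\<beta>\<close> would be
  trivial modulo \<open>\<alpha>\<close> at some point of a class of the centralizer and nontrivial at another. In a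
  modular variety this is impossible. The instance of commutator theory needed for this is proved
  directly, by one application of the modular law in a subalgebra of \<open>A\<^sup>4\<close>
  (\<open>collapse_by_trivial_class\<close>).

  Finally \<open>\<phi> \<bullet> \<psi>\<close> is completely meet irreducible and in \<open>U\<close>, because together with \<open>\<phi>\<close> and \<open>\<psi>\<close> it
  forms the middle layer of a five-element sublattice \<open>M\<^sub>3\<close> (\<open>bullet_Cm_sim\<close>).
\<close>

section \<open>The complete lattice of congruences\<close>

lemma universal_algebra_opn:
  assumes "universal_algebra A" and "length xs = arity A f" and "set xs \<subseteq> carrier A"
  shows "opn A f xs \<in> carrier A"
  using assms unfolding universal_algebra_def by blast

lemma Con_equiv: "\<theta> \<in> Con A \<Longrightarrow> equiv (carrier A) \<theta>"
  by (simp add: Con_def)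

lemma Con_carrier: "\<theta> \<in> Con A \<Longrightarrow> \<theta> \<subseteq> carrier A \<times> carrier A"
  by (simp add: Con_def equiv_def)

lemma Con_refl: "\<theta> \<in> Con A \<Longrightarrow> x \<in> carrier A \<Longrightarrow> (x, x) \<in> \<theta>"
  by (simp add: Con_def equiv_def refl_on_def)

lemma Con_sym: "\<theta> \<in> Con A \<Longrightarrow> (x, y) \<in> \<theta> \<Longrightarrow> (y, x) \<in> \<theta>"
  by (auto simp: Con_def equiv_def sym_def)

lemma Con_trans: "\<theta> \<in> Con A \<Longrightarrow> (x, y) \<in> \<theta> \<Longrightarrow> (y, z) \<in> \<theta> \<Longrightarrow> (x, z) \<in> \<theta>"
  by (auto simp: Con_def equiv_def trans_def)

lemma ConI:
  assumes "equiv (carrier A) \<theta>"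
    and "\<And>f xs ys. length xs = arity A f \<Longrightarrow> list_all2 (\<lambda>x y. (x, y) \<in> \<theta>) xs ys \<Longrightarrow>
      (opn A f xs, opn A f ys) \<in> \<theta>"
  shows "\<theta> \<in> Con A"
  using assms unfolding Con_def by blast

lemma Con_opn:
  "\<theta> \<in> Con A \<Longrightarrow> length xs = arity A f \<Longrightarrow> list_all2 (\<lambda>x y. (x, y) \<in> \<theta>) xs ys \<Longrightarrow>
    (opn A f xs, opn A f ys) \<in> \<theta>"
  by (simp add: Con_def)

lemma Con_opn_map:
  assumes "\<theta> \<in> Con A" and "length ws = arity A f" and "\<And>w. w \<in> set ws \<Longrightarrow> (g w, h w) \<in> \<theta>"
  shows "(opn A f (map g ws), opn A f (map h ws)) \<in> \<theta>"
proof (rule Con_opn[OF assms(1)])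
  show "list_all2 (\<lambda>x y. (x, y) \<in> \<theta>) (map g ws) (map h ws)"
    using assms(3) by (induction ws) auto
qed (use assms(2) in simp)

lemma list_all2_carrier:
  assumes "\<theta> \<subseteq> carrier A \<times> carrier A" and "list_all2 (\<lambda>x y. (x, y) \<in> \<theta>) xs ys"
  shows "set xs \<subseteq> carrier A" and "set ys \<subseteq> carrier A"
  using assms(2,1) by (induction rule: list_all2_induct) auto

lemma Con_Inter:
  assumes A: "universal_algebra A" and S: "S \<subseteq> Con A"
  shows "carrier A \<times> carrier A \<inter> \<Inter> S \<in> Con A"
proof -
  let ?T = "carrier A \<times> carrier A \<inter> \<Inter> S"
  have "equiv (carrier A) ?T"
  proof (rule equivI)
    show "refl_on (carrier A) ?T"
      using S by (auto simp: refl_on_def dest: Con_refl)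
    show "sym ?T"
      using S by (auto simp: sym_def dest: Con_sym)
    show "trans ?T"
      unfolding trans_def using S by (auto intro: Con_trans)
  qed auto
  moreover have "(opn A f xs, opn A f ys) \<in> ?T"
    if len: "length xs = arity A f" and rel: "list_all2 (\<lambda>x y. (x, y) \<in> ?T) xs ys" for f xs ys
  proof -
    have "set xs \<subseteq> carrier A" "set ys \<subseteq> carrier A" "length ys = arity A f"
      using list_all2_carrier[OF _ rel] len list_all2_lengthD[OF rel] by auto
    moreover have "(opn A f xs, opn A f ys) \<in> \<theta>" if "\<theta> \<in> S" for \<theta>
      using that S len by (blast intro: Con_opn list_all2_mono[OF rel])
    ultimately show ?thesis
      using A len by (auto intro: universal_algebra_opn)
  qed
  ultimately show ?thesis
    by (rule ConI)
qed

lemma Con_Int: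
  assumes "universal_algebra A" and "\<alpha> \<in> Con A" and "\<beta> \<in> Con A"
  shows "\<alpha> \<inter> \<beta> \<in> Con A"
proof -
  have "carrier A \<times> carrier A \<inter> \<Inter> {\<alpha>, \<beta>} \<in> Con A"
    using assms by (intro Con_Inter) auto
  moreover have "carrier A \<times> carrier A \<inter> \<Inter> {\<alpha>, \<beta>} = \<alpha> \<inter> \<beta>"
    using assms(2) by (auto dest: Con_carrier)
  ultimately show ?thesis by simp
qed

lemma Con_Id: "universal_algebra A \<Longrightarrow> Id_on (carrier A) \<in> Con A"
proof -
  assume A: "universal_algebra A"
  have "xs = ys \<and> set xs \<subseteq> carrier A" if "list_all2 (\<lambda>x y. (x, y) \<in> Id_on (carrier A)) xs ys"
    for xs ys :: "'a list"
    using that by (induction rule: list_all2_induct) auto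
  with A show ?thesis
    by (auto simp: Con_def equiv_def refl_on_def sym_def trans_def intro: universal_algebra_opn)
qed

text \<open>Principal congruences, joins and covers are all obtained from this.\<close>

lemma Least_Con:
  assumes A: "universal_algebra A"
    and inherited: "\<And>S. S \<subseteq> {\<theta> \<in> Con A. P \<theta>} \<Longrightarrow> P (carrier A \<times> carrier A \<inter> \<Inter> S)"
  shows "(LEAST \<theta>. \<theta> \<in> Con A \<and> P \<theta>) \<in> Con A"
    and "P (LEAST \<theta>. \<theta> \<in> Con A \<and> P \<theta>)"
    and "\<And>\<theta>. \<theta> \<in> Con A \<Longrightarrow> P \<theta> \<Longrightarrow> (LEAST \<theta>. \<theta> \<in> Con A \<and> P \<theta>) \<subseteq> \<theta>"
proof -
  let ?m = "carrier A \<times> carrier A \<inter> \<Inter> {\<theta> \<in> Con A. P \<theta>}"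
  have m: "?m \<in> Con A" "P ?m"
    using Con_Inter[OF A] inherited by (auto 0 3)
  have "(LEAST \<theta>. \<theta> \<in> Con A \<and> P \<theta>) = ?m"
    by (rule Least_equality) (use m in auto)
  with m show "(LEAST \<theta>. \<theta> \<in> Con A \<and> P \<theta>) \<in> Con A" "P (LEAST \<theta>. \<theta> \<in> Con A \<and> P \<theta>)"
    "\<And>\<theta>. \<theta> \<in> Con A \<Longrightarrow> P \<theta> \<Longrightarrow> (LEAST \<theta>. \<theta> \<in> Con A \<and> P \<theta>) \<subseteq> \<theta>"
    by auto
qed

lemma Cg_in_Con:
  assumes "universal_algebra A" and "c \<in> carrier A" and "d \<in> carrier A"
  shows "Cg A c d \<in> Con A" and "(c, d) \<in> Cg A c d"
    and "\<And>\<theta>. \<theta> \<in> Con A \<Longrightarrow> (c, d) \<in> \<theta> \<Longrightarrow> Cg A c d \<subseteq> \<theta>"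
  unfolding Cg_def by (rule Least_Con[of A "\<lambda>\<theta>. (c, d) \<in> \<theta>"]; use assms in auto)+

lemma Con_join_in_Con:
  assumes "universal_algebra A" and "\<alpha> \<in> Con A" and "\<beta> \<in> Con A"
  shows "Con_join A \<alpha> \<beta> \<in> Con A" and "\<alpha> \<subseteq> Con_join A \<alpha> \<beta>" and "\<beta> \<subseteq> Con_join A \<alpha> \<beta>"
    and "\<And>\<theta>. \<theta> \<in> Con A \<Longrightarrow> \<alpha> \<subseteq> \<theta> \<Longrightarrow> \<beta> \<subseteq> \<theta> \<Longrightarrow> Con_join A \<alpha> \<beta> \<subseteq> \<theta>"
proof -
  have "\<alpha> \<subseteq> carrier A \<times> carrier A" "\<beta> \<subseteq> carrier A \<times> carrier A"
    using assms by (auto dest: Con_carrier)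
  then have "\<alpha> \<subseteq> carrier A \<times> carrier A \<inter> \<Inter> S \<and> \<beta> \<subseteq> carrier A \<times> carrier A \<inter> \<Inter> S"
    if "S \<subseteq> {\<theta> \<in> Con A. \<alpha> \<subseteq> \<theta> \<and> \<beta> \<subseteq> \<theta>}" for S
    using that by blast
  note L = Least_Con[OF assms(1), of "\<lambda>\<theta>. \<alpha> \<subseteq> \<theta> \<and> \<beta> \<subseteq> \<theta>", OF this, folded Con_join_def]
  show "Con_join A \<alpha> \<beta> \<in> Con A" "\<alpha> \<subseteq> Con_join A \<alpha> \<beta>" "\<beta> \<subseteq> Con_join A \<alpha> \<beta>"
    "\<And>\<theta>. \<theta> \<in> Con A \<Longrightarrow> \<alpha> \<subseteq> \<theta> \<Longrightarrow> \<beta> \<subseteq> \<theta> \<Longrightarrow> Con_join A \<alpha> \<beta> \<subseteq> \<theta>"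
    using L by auto
qed

text \<open>Arguments can be changed one after the other by transitivity, so an equivalence relation is a
  congruence as soon as it is preserved by the unary maps that arise from the operations by fixing
  all arguments but one. Transitive closures, and later the products \<open>\<phi> \<bullet> \<psi>\<close>, are recognized as
  congruences in this way.\<close>

definition elementary_translations :: "('a, 'f) ualg \<Rightarrow> ('a \<Rightarrow> 'a) set" where
  "elementary_translations A = {\<lambda>x. opn A f (us @ x # vs) | f us vs.
     set us \<subseteq> carrier A \<and> set vs \<subseteq> carrier A \<and> Suc (length us + length vs) = arity A f}"

lemma ConI_translations:
  assumes A: "universal_algebra A" and eqv: "equiv (carrier A) \<theta>"
    and compat: "\<And>s x y. s \<in> elementary_translations A \<Longrightarrow> (x, y) \<in> \<theta> \<Longrightarrow> (s x, s y) \<in> \<theta>"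
  shows "\<theta> \<in> Con A"
proof -
  have "(opn A f (us @ xs), opn A f (us @ ys)) \<in> \<theta>"
    if "list_all2 (\<lambda>x y. (x, y) \<in> \<theta>) xs ys"
      and "set us \<subseteq> carrier A" and "length us + length xs = arity A f" for f us xs ys
    using that
  proof (induction arbitrary: us rule: list_all2_induct)
    case Nil
    then have "opn A f us \<in> carrier A"
      using A by (auto intro: universal_algebra_opn)
    then show ?case
      using eqv by (auto simp: equiv_def refl_on_def)
  next
    case (Cons x xs y ys)
    have sub: "\<theta> \<subseteq> carrier A \<times> carrier A"
      using eqv by (simp add: equiv_def)
    have xs: "set xs \<subseteq> carrier A" and y: "y \<in> carrier A"
      using list_all2_carrier[OF sub Cons(2)] Cons(1) sub by auto
    have "(\<lambda>x. opn A f (us @ x # xs)) \<in> elementary_translations A"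
      unfolding elementary_translations_def using Cons.prems xs by force
    from compat[OF this Cons(1)] have "(opn A f (us @ x # xs), opn A f (us @ y # xs)) \<in> \<theta>" .
    moreover have "(opn A f ((us @ [y]) @ xs), opn A f ((us @ [y]) @ ys)) \<in> \<theta>"
      using Cons.prems y by (intro Cons.IH) auto
    ultimately show ?case
      using eqv by (auto simp: equiv_def dest: transD)
  qed
  from this[of _ _ "[]"] eqv show ?thesis
    by (intro ConI) auto
qed

lemma Con_translation:
  assumes "\<theta> \<in> Con A" and "s \<in> elementary_translations A" and "(x, y) \<in> \<theta>"
  shows "(s x, s y) \<in> \<theta>"
proof -
  obtain f us vs where s: "s = (\<lambda>x. opn A f (us @ x # vs))" "set us \<subseteq> carrier A"
      "set vs \<subseteq> carrier A" "Suc (length us + length vs) = arity A f"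
    using assms(2) unfolding elementary_translations_def by blast
  have diag: "list_all2 (\<lambda>x y. (x, y) \<in> \<theta>) ws ws" if "set ws \<subseteq> carrier A" for ws
    using that Con_refl[OF assms(1)] by (induction ws) auto
  show ?thesis
    unfolding s(1)
    by (intro Con_opn[OF assms(1)] list_all2_appendI) (use s diag assms(3) in auto)
qed

lemma Con_join_trancl:
  assumes A: "universal_algebra A" and "\<alpha> \<in> Con A" and "\<beta> \<in> Con A"
  shows "Con_join A \<alpha> \<beta> \<subseteq> (\<alpha> \<union> \<beta>)\<^sup>+"
proof (rule Con_join_in_Con(4)[OF assms])
  show "(\<alpha> \<union> \<beta>)\<^sup>+ \<in> Con A"
  proof (rule ConI_translations[OF A])
    have "sym (\<alpha> \<union> \<beta>)"
      using assms by (auto simp: sym_def dest: Con_sym)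
    then show "equiv (carrier A) ((\<alpha> \<union> \<beta>)\<^sup>+)"
      using assms Con_carrier[OF assms(2)] Con_carrier[OF assms(3)]
      by (intro equivI trancl_subset_Sigma sym_trancl trans_trancl)
        (auto simp: refl_on_def dest: Con_refl)
    show "(s x, s y) \<in> (\<alpha> \<union> \<beta>)\<^sup>+" if s: "s \<in> elementary_translations A" and xy: "(x, y) \<in> (\<alpha> \<union> \<beta>)\<^sup>+" for s x y
      using xy
    proof (induction rule: trancl_induct)
      case (base y)
      then show ?case
        using s assms by (auto dest: Con_translation)
    next
      case (step y z)
      then have "(s y, s z) \<in> \<alpha> \<union> \<beta>"
        using s assms by (auto dest: Con_translation)
      with step.IH show ?case
        by (rule trancl_into_trancl)
    qed
  qed
qed auto

lemma modular_law:
  assumes "congruence_modular A" and "\<alpha> \<in> Con A" "\<beta> \<in> Con A" "\<gamma> \<in> Con A" and "\<alpha> \<subseteq> \<gamma>"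
  shows "Con_join A \<alpha> (\<beta> \<inter> \<gamma>) = Con_join A \<alpha> \<beta> \<inter> \<gamma>"
  using assms unfolding congruence_modular_def by blast

section \<open>Completely meet irreducible congruences\<close>

text \<open>Operations have finite arity: the finitely many pairs of arguments to which compatibility
  applies already lie in one member of the chain. So the congruence lattice is algebraic.\<close>

lemma Con_chain_Union:
  assumes ne: "C \<noteq> {}" and ch: "subset.chain (Con A) C"
  shows "\<Union> C \<in> Con A"
proof -
  have C: "C \<subseteq> Con A" and tot: "\<And>\<theta> \<kappa>. \<theta> \<in> C \<Longrightarrow> \<kappa> \<in> C \<Longrightarrow> \<theta> \<subseteq> \<kappa> \<or> \<kappa> \<subseteq> \<theta>"
    using ch by (auto simp: subset.chain_def)
  have one: "\<exists>\<theta>\<in>C. list_all2 (\<lambda>x y. (x, y) \<in> \<theta>) xs ys"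
    if "list_all2 (\<lambda>x y. (x, y) \<in> \<Union> C) xs ys" for xs ys
    using that
  proof (induction rule: list_all2_induct)
    case Nil
    then show ?case using ne by auto
  next
    case (Cons x xs y ys)
    then obtain \<theta> \<kappa> where \<theta>: "\<theta> \<in> C" "(x, y) \<in> \<theta>"
      and \<kappa>: "\<kappa> \<in> C" "list_all2 (\<lambda>x y. (x, y) \<in> \<kappa>) xs ys" by blast
    show ?case
    proof (cases "\<theta> \<subseteq> \<kappa>")
      case True
      with \<theta> \<kappa> show ?thesis by auto
    next
      case False
      with tot[OF \<theta>(1) \<kappa>(1)] have "\<kappa> \<subseteq> \<theta>" by simp
      then have "list_all2 (\<lambda>x y. (x, y) \<in> \<theta>) xs ys"
        using \<kappa>(2) by (auto elim: list_all2_mono)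
      with \<theta> show ?thesis by auto
    qed
  qed
  have "equiv (carrier A) (\<Union> C)"
  proof (rule equivI)
    show "\<Union> C \<subseteq> carrier A \<times> carrier A" "refl_on (carrier A) (\<Union> C)" "sym (\<Union> C)"
      using C ne by (auto 0 4 simp: refl_on_def sym_def dest: Con_carrier Con_refl Con_sym)
    show "trans (\<Union> C)"
    proof (rule transI)
      fix x y z assume "(x, y) \<in> \<Union> C" "(y, z) \<in> \<Union> C"
      then obtain \<theta> \<kappa> where "\<theta> \<in> C" "(x, y) \<in> \<theta>" "\<kappa> \<in> C" "(y, z) \<in> \<kappa>" by blast
      moreover from this have "\<theta> \<subseteq> \<kappa> \<or> \<kappa> \<subseteq> \<theta>" by (intro tot)
      ultimately show "(x, z) \<in> \<Union> C"
        using C by (blast intro: Con_trans)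
    qed
  qed
  moreover have "(opn A f xs, opn A f ys) \<in> \<Union> C"
    if "length xs = arity A f" "list_all2 (\<lambda>x y. (x, y) \<in> \<Union> C) xs ys" for f xs ys
    using one[OF that(2)] that(1) C by (blast intro: Con_opn)
  ultimately show ?thesis
    by (rule ConI)
qed

text \<open>By Zorn's lemma there is a congruence \<open>\<mu>\<close> maximal among those above \<open>\<theta>\<close> that omit \<open>(x, y)\<close>.
  All congruences properly above \<open>\<mu>\<close> contain \<open>(x, y)\<close>, hence so do their meets, and \<open>\<mu>\<close> is
  completely meet irreducible. The maximality is kept in the conclusion because it places
  \<open>(x, y)\<close> in the cover of \<open>\<mu>\<close>.\<close>

lemma Cm_separates:
  assumes "\<theta> \<in> Con A" and "(x, y) \<notin> \<theta>" and "x \<in> carrier A" "y \<in> carrier A"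
  obtains \<mu> where "\<mu> \<in> Cm A" and "\<theta> \<subseteq> \<mu>" and "(x, y) \<notin> \<mu>"
    and "\<And>\<kappa>. \<kappa> \<in> Con A \<Longrightarrow> \<mu> \<subset> \<kappa> \<Longrightarrow> (x, y) \<in> \<kappa>"
proof -
  let ?S = "{\<kappa> \<in> Con A. \<theta> \<subseteq> \<kappa> \<and> (x, y) \<notin> \<kappa>}"
  have "\<exists>\<mu>\<in>?S. \<forall>\<kappa>\<in>?S. \<mu> \<subseteq> \<kappa> \<longrightarrow> \<kappa> = \<mu>"
  proof (rule subset_Zorn_nonempty)
    show "?S \<noteq> {}" using assms by auto
  next
    fix C assume C: "C \<noteq> {}" "subset.chain ?S C"
    then have "C \<subseteq> ?S"
      by (simp add: subset.chain_def)
    moreover have "\<theta> \<subseteq> \<Union> C"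
      using C(1) \<open>C \<subseteq> ?S\<close> by blast
    moreover have "subset.chain (Con A) C"
      using C(2) by (auto simp: subset.chain_def)
    ultimately show "\<Union> C \<in> ?S"
      using Con_chain_Union[OF C(1)] by auto
  qed
  then obtain \<mu> where \<mu>: "\<mu> \<in> Con A" "\<theta> \<subseteq> \<mu>" "(x, y) \<notin> \<mu>"
    and maximal: "\<forall>\<kappa>\<in>?S. \<mu> \<subseteq> \<kappa> \<longrightarrow> \<kappa> = \<mu>" by auto
  have max: "(x, y) \<in> \<kappa>" if "\<kappa> \<in> Con A" "\<mu> \<subset> \<kappa>" for \<kappa>
  proof (rule ccontr)
    assume "(x, y) \<notin> \<kappa>"
    then have "\<kappa> \<in> ?S"
      using \<mu>(2) that by auto
    with maximal that(2) show False by auto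
  qed
  have "\<mu> \<in> S" if S: "S \<subseteq> Con A" "carrier A \<times> carrier A \<inter> \<Inter> S = \<mu>" for S
  proof (rule ccontr)
    assume "\<mu> \<notin> S"
    have "(x, y) \<in> \<kappa>" if "\<kappa> \<in> S" for \<kappa>
    proof (rule max)
      show "\<kappa> \<in> Con A"
        using S(1) that by (rule subsetD)
      have "\<mu> \<subseteq> \<kappa>"
        unfolding S(2)[symmetric] using that by blast
      moreover have "\<kappa> \<noteq> \<mu>"
        using that \<open>\<mu> \<notin> S\<close> by metis
      ultimately show "\<mu> \<subset> \<kappa>" by simp
    qed
    then have "(x, y) \<in> \<mu>"
      unfolding S(2)[symmetric] using assms(3,4) by simp
    with \<mu>(3) show False ..
  qed
  then have "\<mu> \<in> Cm A"
    using \<mu>(1) by (auto simp: Cm_def)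
  from that[OF this \<mu>(2,3) max] show ?thesis .
qed

lemma Cm_Con: "\<eta> \<in> Cm A \<Longrightarrow> \<eta> \<in> Con A"
  by (simp add: Cm_def)

lemma cover_props:
  assumes A: "universal_algebra A" and \<eta>: "\<eta> \<in> Cm A"
  shows "cover A \<eta> \<in> Con A" and "\<eta> \<subset> cover A \<eta>"
    and "\<And>\<theta>. \<theta> \<in> Con A \<Longrightarrow> \<eta> \<subset> \<theta> \<Longrightarrow> cover A \<eta> \<subseteq> \<theta>"
proof -
  have "\<eta> \<subset> carrier A \<times> carrier A \<inter> \<Inter> S" if "S \<subseteq> {\<theta> \<in> Con A. \<eta> \<subset> \<theta>}" for S
  proof -
    have "carrier A \<times> carrier A \<inter> \<Inter> S \<noteq> \<eta>"
      using \<eta> that unfolding Cm_def by blast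
    moreover have "\<eta> \<subseteq> carrier A \<times> carrier A \<inter> \<Inter> S"
      using Con_carrier[OF Cm_Con[OF \<eta>]] that by blast
    ultimately show ?thesis by blast
  qed
  note L = Least_Con[OF A, of "\<lambda>\<theta>. \<eta> \<subset> \<theta>", OF this, folded cover_def]
  show "cover A \<eta> \<in> Con A" "\<eta> \<subset> cover A \<eta>"
    "\<And>\<theta>. \<theta> \<in> Con A \<Longrightarrow> \<eta> \<subset> \<theta> \<Longrightarrow> cover A \<eta> \<subseteq> \<theta>"
    using L by auto
qed

section \<open>Homomorphisms\<close>

lemma alg_hom_opn:
  assumes "alg_hom A B h" and "set xs \<subseteq> carrier A" and "length xs = arity A f"
  shows "h (opn A f xs) = opn B f (map h xs)"
  using assms unfolding alg_hom_def by simp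

definition pullback :: "('a, 'f) ualg \<Rightarrow> ('a \<Rightarrow> 'b) \<Rightarrow> 'b rel \<Rightarrow> 'a rel" where
  "pullback A h \<theta> = {(x, y). x \<in> carrier A \<and> y \<in> carrier A \<and> (h x, h y) \<in> \<theta>}"

lemma pullback_Con:
  assumes A: "universal_algebra A" and ar: "arity B = arity A" and h: "alg_hom A B h"
    and \<theta>: "\<theta> \<in> Con B"
  shows "pullback A h \<theta> \<in> Con A"
proof -
  have hc: "h x \<in> carrier B" if "x \<in> carrier A" for x
    using h that by (auto simp: alg_hom_def)
  have "equiv (carrier A) (pullback A h \<theta>)"
    by (rule equivI)
      (auto simp: pullback_def refl_on_def sym_def trans_def
        intro: hc Con_refl[OF \<theta>] Con_sym[OF \<theta>] Con_trans[OF \<theta>])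
  moreover have "(opn A f xs, opn A f ys) \<in> pullback A h \<theta>"
    if len: "length xs = arity A f" and rel: "list_all2 (\<lambda>x y. (x, y) \<in> pullback A h \<theta>) xs ys"
    for f xs ys
  proof -
    have "pullback A h \<theta> \<subseteq> carrier A \<times> carrier A"
      by (auto simp: pullback_def)
    note c = list_all2_carrier[OF this rel]
    have len': "length ys = arity A f"
      using rel len by (simp add: list_all2_lengthD)
    have "list_all2 (\<lambda>x y. (x, y) \<in> \<theta>) (map h xs) (map h ys)"
      using rel by (auto simp: list_all2_map1 list_all2_map2 pullback_def elim: list_all2_mono)
    then have "(opn B f (map h xs), opn B f (map h ys)) \<in> \<theta>"
      using len ar by (intro Con_opn[OF \<theta>]) auto
    then show ?thesis
      using A h c len len' by (auto simp: pullback_def alg_hom_def intro: universal_algebra_opn)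
  qed
  ultimately show ?thesis
    by (rule ConI)
qed

lemma eval_trm_closed:
  assumes "universal_algebra A" and "v \<in> UNIV \<rightarrow> carrier A"
  shows "wf_trm (arity A) s \<Longrightarrow> eval_trm A v s \<in> carrier A"
proof (induction s)
  case (App f ts)
  then show ?case
    using assms by (auto intro!: universal_algebra_opn)
qed (use assms in auto)

lemma alg_hom_eval_trm:
  assumes "universal_algebra A" and "alg_hom A B h" and "v \<in> UNIV \<rightarrow> carrier A"
  shows "wf_trm (arity A) s \<Longrightarrow> h (eval_trm A v s) = eval_trm B (\<lambda>x. h (v x)) s"
proof (induction s)
  case (App f ts)
  then have wf: "length ts = arity A f" "\<And>s. s \<in> set ts \<Longrightarrow> wf_trm (arity A) s"
    by auto
  have "h (opn A f (map (eval_trm A v) ts)) = opn B f (map h (map (eval_trm A v) ts))"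
    using wf eval_trm_closed[OF assms(1,3)] by (intro alg_hom_opn[OF assms(2)]) auto
  moreover have "map h (map (eval_trm A v) ts) = map (eval_trm B (\<lambda>x. h (v x))) ts"
    unfolding map_map by (rule map_cong[OF refl]) (simp only: o_apply App.IH wf)
  ultimately show ?case
    by (simp only: eval_trm.simps)
qed (simp only: eval_trm.simps)

text \<open>Both sides of an identity can be compared after every \<open>h i\<close>, where they are values in \<open>A\<close>.\<close>

lemma in_generated_varietyI:
  assumes B: "universal_algebra B" and ar: "arity B = arity A"
    and hom: "\<And>i. alg_hom B A (h i)"
    and sep: "\<And>x y. x \<in> carrier B \<Longrightarrow> y \<in> carrier B \<Longrightarrow> (\<And>i. h i x = h i y) \<Longrightarrow> x = y"
  shows "in_generated_variety A B"
  unfolding in_generated_variety_def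
proof (intro conjI allI impI)
  fix s t :: "('b, nat) trm"
  assume st: "wf_trm (arity A) s \<and> wf_trm (arity A) t \<and> satisfies A s t"
  show "satisfies B s t"
    unfolding satisfies_def
  proof
    fix v :: "nat \<Rightarrow> 'a"
    assume v: "v \<in> UNIV \<rightarrow> carrier B"
    show "eval_trm B v s = eval_trm B v t"
    proof (rule sep)
      show "eval_trm B v s \<in> carrier B" "eval_trm B v t \<in> carrier B"
        using st ar by (auto intro!: eval_trm_closed[OF B v])
      fix i
      have "(\<lambda>x. h i (v x)) \<in> UNIV \<rightarrow> carrier A"
        using v hom[of i] by (auto simp: alg_hom_def)
      then have "eval_trm A (\<lambda>x. h i (v x)) s = eval_trm A (\<lambda>x. h i (v x)) t"
        using st by (simp add: satisfies_def)
      then show "h i (eval_trm B v s) = h i (eval_trm B v t)"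
        using st ar by (simp add: alg_hom_eval_trm[OF B hom v])
    qed
  qed
qed (use B ar in auto)

section \<open>Subalgebras of powers\<close>

text \<open>The type over which the members of the generated variety range has room for the elements of
  any countable power of \<open>A\<close>: an element is a countable set of pairs of a component and an index,
  and \<open>('a + nat) \<times> ('a + nat)\<close> embeds into the infinite set \<open>'a + nat\<close>.\<close>

lemma ex_inj_pairing: "\<exists>p :: ('a + nat) \<times> ('a + nat) \<Rightarrow> 'a + nat. inj p"
proof -
  have inf: "infinite (UNIV :: ('a + nat) set)"
    by simp
  obtain p :: "('a + nat) \<times> ('a + nat) \<Rightarrow> 'a + nat" where "bij_betw p (UNIV \<times> UNIV) UNIV"
    using card_of_Times_same_infinite[OF inf, folded card_of_ordIso] ..
  then have "inj p"
    unfolding bij_betw_def by simp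
  then show ?thesis by (intro exI)
qed

definition pairing :: "('a + nat) \<times> ('a + nat) \<Rightarrow> 'a + nat" where
  "pairing = (SOME p. inj p)"

lemma inj_pairing: "inj pairing"
  using someI_ex[OF ex_inj_pairing] by (simp only: pairing_def)

text \<open>The graph of \<open>w\<close>, written as a set of variables.\<close>

definition code :: "('i :: countable \<Rightarrow> 'a) \<Rightarrow> ('f, 'a + nat) trm set" where
  "code w = range (\<lambda>i. Var (pairing (Inl (w i), Inr (to_nat i))))"

lemma inj_code: "inj (code :: ('i :: countable \<Rightarrow> 'a) \<Rightarrow> ('f, 'a + nat) trm set)"
proof (rule injI, rule ext)
  fix w w' :: "'i \<Rightarrow> 'a" and i
  assume eq: "(code w :: ('f, 'a + nat) trm set) = code w'"
  have "(Var (pairing (Inl (w i), Inr (to_nat i))) :: ('f, 'a + nat) trm) \<in> code w"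
    unfolding code_def by (rule rangeI)
  then have "(Var (pairing (Inl (w i), Inr (to_nat i))) :: ('f, 'a + nat) trm) \<in> code w'"
    by (simp only: eq)
  then obtain j where "(Var (pairing (Inl (w i), Inr (to_nat i))) :: ('f, 'a + nat) trm) =
      Var (pairing (Inl (w' j), Inr (to_nat j)))"
    unfolding code_def by (rule rangeE)
  then have "pairing (Inl (w i), Inr (to_nat i)) = pairing (Inl (w' j), Inr (to_nat j))"
    by (simp only: trm.inject)
  from injD[OF inj_pairing this] have "w i = w' j" "i = j"
    by auto
  then show "w i = w' i"
    by (simp only:)
qed

definition component :: "'i :: countable \<Rightarrow> ('f, 'a + nat) trm set \<Rightarrow> 'a" where
  "component i z = inv_into UNIV code z i"

lemma component_code [simp]: "component i (code w) = w i"
  by (simp add: component_def inj_code)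

definition coded_subpower ::
    "('a, 'f) ualg \<Rightarrow> ('i :: countable \<Rightarrow> 'a) set \<Rightarrow> (('f, 'a + nat) trm set, 'f) ualg" where
  "coded_subpower A D = \<lparr>carrier = code ` D, arity = arity A,
     opn = (\<lambda>f zs. code (\<lambda>i :: 'i. opn A f (map (component i) zs)))\<rparr>"

definition subpower :: "('a, 'f) ualg \<Rightarrow> ('i \<Rightarrow> 'a) set \<Rightarrow> bool" where
  "subpower A D \<longleftrightarrow> D \<noteq> {} \<and> (\<forall>w\<in>D. range w \<subseteq> carrier A) \<and>
     (\<forall>f ws. length ws = arity A f \<and> set ws \<subseteq> D \<longrightarrow> (\<lambda>i. opn A f (map (\<lambda>w. w i) ws)) \<in> D)"

lemma coded_subpower:
  fixes A :: "('a, 'f) ualg" and D :: "('i :: countable \<Rightarrow> 'a) set" and i :: 'i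
  assumes D: "subpower A D"
  shows "universal_algebra (coded_subpower A D)"
    and "alg_hom (coded_subpower A D) A (component i)"
    and "generates_modular_variety A \<Longrightarrow> congruence_modular (coded_subpower A D)"
proof -
  let ?B = "coded_subpower A D"
  have carrier: "carrier ?B = code ` D" and arity: "arity ?B = arity A"
    and opn: "opn ?B f zs = code (\<lambda>i :: 'i. opn A f (map (component i) zs))" for f zs
    by (simp_all add: coded_subpower_def)
  have comp_carrier: "component i z \<in> carrier A" if "z \<in> carrier ?B" for i :: 'i and z
  proof -
    obtain w where "w \<in> D" "z = code w"
      using \<open>z \<in> carrier ?B\<close> unfolding carrier by (rule imageE)
    moreover from this have "range w \<subseteq> carrier A"
      using D by (simp add: subpower_def)
    ultimately show ?thesis
      by auto
  qed
  have "opn ?B f zs \<in> carrier ?B" if "length zs = arity ?B f" and "set zs \<subseteq> carrier ?B" for f zs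
  proof -
    have "zs \<in> map code ` lists D"
      using that(2) by (simp add: carrier lists_image[symmetric] in_lists_conv_set subset_iff)
    then obtain ws where ws: "zs = map code ws" "set ws \<subseteq> D"
      by (elim imageE) (simp add: lists_eq_set)
    have "(\<lambda>i. opn A f (map (\<lambda>w. w i) ws)) \<in> D"
      using D ws that(1) unfolding subpower_def arity by simp
    then show ?thesis
      unfolding carrier opn ws(1) by (simp add: comp_def)
  qed
  moreover have "carrier ?B \<noteq> {}"
    using D by (simp add: carrier subpower_def)
  ultimately show univ: "universal_algebra ?B"
    unfolding universal_algebra_def by blast
  have hom: "alg_hom ?B A (component i)" for i :: 'i
    unfolding alg_hom_def opn using comp_carrier by simp
  then show "alg_hom ?B A (component i)" .
  have sep: "x = y" if "x \<in> carrier ?B" "y \<in> carrier ?B" "\<And>i :: 'i. component i x = component i y" for x y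
  proof -
    from that(1,2) obtain w w' :: "'i \<Rightarrow> 'a" where w: "x = code w" "y = code w'"
      unfolding carrier by blast
    with that(3) have "w = w'" by (intro ext) simp
    with w show ?thesis by simp
  qed
  have "in_generated_variety A ?B"
    by (rule in_generated_varietyI[OF univ arity hom]) (rule sep)
  then show "generates_modular_variety A \<Longrightarrow> congruence_modular ?B"
    by (simp add: generates_modular_variety_def)
qed

text \<open>Pulling back along \<open>h\<close> embeds the congruences of \<open>A\<close> into those of \<open>B\<close> and preserves meets;
  pulling back along \<open>g\<close> returns to \<open>A\<close> and shows that joins computed in \<open>A\<close> are at most those
  computed in \<open>B\<close>.\<close>

lemma congruence_modular_retract:
  assumes A: "universal_algebra A" and B: "universal_algebra B" and ar: "arity B = arity A"
    and g: "alg_hom A B g" and h: "alg_hom B A h" and hg: "\<And>x. x \<in> carrier A \<Longrightarrow> h (g x) = x"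
    and modB: "congruence_modular B"
  shows "congruence_modular A"
  unfolding congruence_modular_def
proof (intro ballI impI equalityI)
  fix \<alpha> \<beta> \<gamma>
  assume C: "\<alpha> \<in> Con A" "\<beta> \<in> Con A" "\<gamma> \<in> Con A" and le: "\<alpha> \<subseteq> \<gamma>"
  have bg: "\<beta> \<inter> \<gamma> \<in> Con A"
    by (rule Con_Int[OF A C(2,3)])
  show "Con_join A \<alpha> (\<beta> \<inter> \<gamma>) \<subseteq> Con_join A \<alpha> \<beta> \<inter> \<gamma>"
  proof (rule Con_join_in_Con(4)[OF A C(1) bg Con_Int[OF A Con_join_in_Con(1)[OF A C(1,2)] C(3)]])
  qed (use Con_join_in_Con(2,3)[OF A C(1,2)] le in auto)
  have pull: "pullback B h \<theta> \<in> Con B" if "\<theta> \<in> Con A" for \<theta>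
    using pullback_Con[OF B _ h that] ar by simp
  have into: "\<theta> \<subseteq> pullback A g \<kappa>"
    if "\<theta> \<in> Con A" and sub: "pullback B h \<theta> \<subseteq> \<kappa>" for \<theta> \<kappa>
  proof (rule subrelI)
    fix x y assume xy: "(x, y) \<in> \<theta>"
    then have c: "x \<in> carrier A" "y \<in> carrier A"
      using Con_carrier[OF that(1)] by auto
    then have "(g x, g y) \<in> pullback B h \<theta>"
      using xy hg g by (auto simp: pullback_def alg_hom_def)
    with sub c show "(x, y) \<in> pullback A g \<kappa>"
      by (auto simp: pullback_def)
  qed
  let ?j = "Con_join B (pullback B h \<alpha>) (pullback B h \<beta>)"
  let ?k = "pullback B h (Con_join A \<alpha> (\<beta> \<inter> \<gamma>))"
  have j: "?j \<in> Con B" "pullback B h \<alpha> \<subseteq> ?j" "pullback B h \<beta> \<subseteq> ?j"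
    by (rule Con_join_in_Con[OF B pull[OF C(1)] pull[OF C(2)]])+
  have sub: "Con_join A \<alpha> \<beta> \<subseteq> pullback A g ?j"
    by (rule Con_join_in_Con(4)[OF A C(1,2) pullback_Con[OF A ar g j(1)]])
      (rule into[OF C(1) j(2)] into[OF C(2) j(3)])+
  have "Con_join B (pullback B h \<alpha>) (pullback B h \<beta> \<inter> pullback B h \<gamma>) \<subseteq> ?k"
  proof (rule Con_join_in_Con(4)[OF B pull[OF C(1)] Con_Int[OF B pull[OF C(2)] pull[OF C(3)]]
        pull[OF Con_join_in_Con(1)[OF A C(1) bg]]])
  qed (use Con_join_in_Con(2,3)[OF A C(1) bg] in \<open>auto simp: pullback_def\<close>)
  moreover have "pullback B h \<alpha> \<subseteq> pullback B h \<gamma>"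
    using le by (auto simp: pullback_def)
  ultimately have law: "?j \<inter> pullback B h \<gamma> \<subseteq> ?k"
    using modular_law[OF modB pull[OF C(1)] pull[OF C(2)] pull[OF C(3)]] by simp
  show "Con_join A \<alpha> \<beta> \<inter> \<gamma> \<subseteq> Con_join A \<alpha> (\<beta> \<inter> \<gamma>)"
  proof (rule subrelI)
    fix x y assume "(x, y) \<in> Con_join A \<alpha> \<beta> \<inter> \<gamma>"
    then have "(x, y) \<in> pullback A g ?j" "(x, y) \<in> pullback A g (pullback B h \<gamma>)"
      using sub into[OF C(3) subset_refl] by auto
    then have c: "x \<in> carrier A" "y \<in> carrier A" and "(g x, g y) \<in> ?k"
      using law by (auto simp: pullback_def)
    then have "(h (g x), h (g y)) \<in> Con_join A \<alpha> (\<beta> \<inter> \<gamma>)"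
      by (simp add: pullback_def)
    with c hg show "(x, y) \<in> Con_join A \<alpha> (\<beta> \<inter> \<gamma>)"
      by simp
  qed
qed

text \<open>The variety is only known to be modular over its large type, so \<open>A\<close> is replaced by its
  isomorphic copy, the first power.\<close>

lemma congruence_modular_self:
  assumes A: "universal_algebra A" and gen: "generates_modular_variety A"
  shows "congruence_modular A"
proof -
  let ?D = "{w :: unit \<Rightarrow> 'a. range w \<subseteq> carrier A}"
  let ?B = "coded_subpower A ?D"
  have D: "subpower A ?D"
    unfolding subpower_def
  proof (intro conjI allI impI)
    obtain x where "x \<in> carrier A"
      using A by (auto simp: universal_algebra_def)
    then have "(\<lambda>_. x) \<in> ?D" by auto
    then show "?D \<noteq> {}" by blast
  next
    fix f and ws :: "(unit \<Rightarrow> 'a) list"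
    assume "length ws = arity A f \<and> set ws \<subseteq> ?D"
    then have "opn A f (map (\<lambda>w. w i) ws) \<in> carrier A" for i
      by (intro universal_algebra_opn[OF A]) auto
    then show "(\<lambda>i. opn A f (map (\<lambda>w. w i) ws)) \<in> ?D"
      by auto
  qed auto
  note B = coded_subpower[OF D]
  have g: "alg_hom A ?B (\<lambda>x. code (\<lambda>_ :: unit. x))"
    unfolding alg_hom_def by (auto simp: coded_subpower_def comp_def intro!: imageI)
  have "arity ?B = arity A"
    by (simp add: coded_subpower_def)
  from congruence_modular_retract[OF A B(1) this g B(2) _ B(3)[OF gen]] show ?thesis
    by simp
qed

section \<open>Congruences with a common transpose centralize it\<close>

text \<open>The rows \<open>(p, q)\<close> and \<open>(r, s)\<close> of a matrix below are elements of the subalgebra \<open>\<beta>\<close> of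
  \<open>A\<^sup>2\<close>, and they are related by the composite of the congruences that \<open>\<psi>\<close> and \<open>\<phi>\<close> induce on that
  subalgebra, with \<open>(m, n)\<close> in between. Commutator theory uses the join of the two congruences; the
  composite is enough here and is visibly closed under the operations.\<close>

definition matrix :: "'a \<Rightarrow> 'a \<Rightarrow> 'a \<Rightarrow> 'a \<Rightarrow> bool \<times> bool \<Rightarrow> 'a" where
  "matrix p q r s = (\<lambda>(i, j). if i then if j then s else r else if j then q else p)"

definition centrality_matrices ::
    "('a, 'f) ualg \<Rightarrow> 'a rel \<Rightarrow> 'a rel \<Rightarrow> 'a rel \<Rightarrow> (bool \<times> bool \<Rightarrow> 'a) set" where
  "centrality_matrices A \<phi> \<psi> \<beta> = {matrix p q r s | p q r s. (p, q) \<in> \<beta> \<and> (r, s) \<in> \<beta> \<and>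
     (\<exists>m n. (m, n) \<in> \<beta> \<and> (p, m) \<in> \<psi> \<and> (q, n) \<in> \<psi> \<and> (m, r) \<in> \<phi> \<and> (n, s) \<in> \<phi>)}"

lemma matrix_simps [simp]:
  "matrix p q r s (False, False) = p" "matrix p q r s (False, True) = q"
  "matrix p q r s (True, False) = r" "matrix p q r s (True, True) = s"
  by (simp_all add: matrix_def)

lemma matrix_eta: "matrix (w (False, False)) (w (False, True)) (w (True, False)) (w (True, True)) = w"
  by (auto simp: matrix_def fun_eq_iff)

lemma subpower_centrality_matrices:
  assumes A: "universal_algebra A" and C: "\<phi> \<in> Con A" "\<psi> \<in> Con A" "\<beta> \<in> Con A"
  shows "subpower A (centrality_matrices A \<phi> \<psi> \<beta>)"
  unfolding subpower_def
proof (intro conjI allI impI ballI)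
  let ?D = "centrality_matrices A \<phi> \<psi> \<beta>"
  obtain x where "x \<in> carrier A"
    using A by (auto simp: universal_algebra_def)
  then have "matrix x x x x \<in> ?D"
    unfolding centrality_matrices_def using C by (blast intro: Con_refl)
  then show "?D \<noteq> {}" by blast
  show "range w \<subseteq> carrier A" if "w \<in> ?D" for w
    using that Con_carrier[OF C(3)] by (auto simp: centrality_matrices_def matrix_def)
  fix f and ws
  assume "length ws = arity A f \<and> set ws \<subseteq> ?D"
  then have len: "length ws = arity A f" and ws: "set ws \<subseteq> ?D" by auto
  define P where "P w m n \<longleftrightarrow> (m, n) \<in> \<beta> \<and> (w (False, False), m) \<in> \<psi> \<and> (w (False, True), n) \<in> \<psi> \<and>
    (m, w (True, False)) \<in> \<phi> \<and> (n, w (True, True)) \<in> \<phi>" for w m n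
  have elem: "w \<in> ?D \<longleftrightarrow> (w (False, False), w (False, True)) \<in> \<beta> \<and>
      (w (True, False), w (True, True)) \<in> \<beta> \<and> (\<exists>m n. P w m n)" for w
  proof
    assume "w \<in> ?D"
    then show "(w (False, False), w (False, True)) \<in> \<beta> \<and>
      (w (True, False), w (True, True)) \<in> \<beta> \<and> (\<exists>m n. P w m n)"
      unfolding centrality_matrices_def P_def by (simp only: mem_Collect_eq) (elim exE conjE, simp, blast)
  next
    assume "(w (False, False), w (False, True)) \<in> \<beta> \<and>
      (w (True, False), w (True, True)) \<in> \<beta> \<and> (\<exists>m n. P w m n)"
    then have "matrix (w (False, False)) (w (False, True)) (w (True, False)) (w (True, True)) \<in> ?D"
      unfolding centrality_matrices_def P_def by blast
    then show "w \<in> ?D" by (simp only: matrix_eta)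
  qed
  have "\<forall>w\<in>set ws. \<exists>m n. P w m n"
    using ws elem by blast
  then obtain m n where P: "\<And>w. w \<in> set ws \<Longrightarrow> P w (m w) (n w)"
    by metis
  let ?w = "\<lambda>i. opn A f (map (\<lambda>w. w i) ws)"
  have "P ?w (opn A f (map m ws)) (opn A f (map n ws))"
    unfolding P_def
    by (intro conjI Con_opn_map[OF C(1) len] Con_opn_map[OF C(2) len] Con_opn_map[OF C(3) len])
      (use P in \<open>auto simp: P_def\<close>)
  moreover have "(?w (False, False), ?w (False, True)) \<in> \<beta>" "(?w (True, False), ?w (True, True)) \<in> \<beta>"
    using ws elem by (auto intro!: Con_opn_map[OF C(3) len])
  ultimately show "?w \<in> ?D"
    unfolding elem by blast
qed

text \<open>Let \<open>\<alpha>\<close> be the common intersection of \<open>\<beta>\<close> with \<open>\<phi>\<close> and with \<open>\<psi>\<close>. If the lower row of a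
  matrix lies in \<open>\<alpha>\<close>, then so does the intermediate row, by \<open>\<beta> \<inter> \<phi> = \<alpha>\<close>, and then the upper row,
  by \<open>\<beta> \<inter> \<psi> = \<alpha>\<close>: in the language of commutators, \<open>\<beta>\<close> is centralized modulo \<open>\<alpha>\<close>. In a modular
  variety this forces the \<open>\<beta>\<close>-classes inside one class of the centralizer to have the same shape
  modulo \<open>\<alpha>\<close>. The elements \<open>a\<close>, \<open>e\<close> and \<open>c\<close> are connected by \<open>\<phi>\<close> and \<open>\<psi>\<close>, and the \<open>\<beta>\<close>-class of
  \<open>a\<close> is trivial modulo \<open>\<alpha>\<close>, so \<open>e\<close> and \<open>c\<close> cannot differ modulo \<open>\<alpha>\<close>.

  To see this with the modular law alone, consider the matrices \<open>x, y, z, u\<close> with the rows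
  \<open>(e, e), (a, a)\<close>; \<open>(e, e), (e, e)\<close>; \<open>(e, c), (e, c)\<close>; \<open>(c, c), (a, a)\<close>.
  Going from \<open>x\<close> to \<open>u\<close> through \<open>y\<close> and \<open>z\<close>, the first and third step keep the entry \<open>q\<close>, the second
  keeps \<open>p\<close> and moves \<open>s\<close> inside its \<open>\<beta>\<close>-class. The modular law yields another path, on which \<open>s\<close>
  stays in the \<open>\<beta>\<close>-class of \<open>a\<close> all the time. There the lower rows lie in \<open>\<alpha>\<close>, hence so do the upper
  rows, and every step, whether it keeps \<open>p\<close> or \<open>q\<close>, leaves \<open>p\<close> unchanged modulo \<open>\<phi>\<close>. As \<open>p\<close> is
  \<open>e\<close> at the start and \<open>c\<close> at the end, these are related.\<close>

lemma collapse_by_trivial_class: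
  fixes A :: "('a, 'f) ualg"
  assumes A: "universal_algebra A" and gen: "generates_modular_variety A"
    and C: "\<phi> \<in> Con A" "\<psi> \<in> Con A" "\<beta> \<in> Con A" and eq: "\<beta> \<inter> \<phi> = \<beta> \<inter> \<psi>"
    and ec: "(e, c) \<in> \<beta>" and ed: "(e, d) \<in> \<phi>" and dc: "(d, c) \<in> \<psi>"
    and ea: "(e, a) \<in> \<phi>" and trivial: "\<And>x. (a, x) \<in> \<beta> \<Longrightarrow> (a, x) \<in> \<phi>"
  shows "(e, c) \<in> \<phi>"
proof -
  let ?D = "centrality_matrices A \<phi> \<psi> \<beta>"
  let ?B = "coded_subpower A ?D"
  note D = subpower_centrality_matrices[OF A C]
  note B = coded_subpower[OF D]
  have carB: "carrier ?B = code ` ?D" and arB: "arity A = arity ?B"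
    by (simp_all add: coded_subpower_def)
  have car: "a \<in> carrier A" "c \<in> carrier A" "d \<in> carrier A" "e \<in> carrier A"
    using ea ec ed Con_carrier[OF C(1)] Con_carrier[OF C(3)] by auto
  note refl = Con_refl[OF C(1)] Con_refl[OF C(2)] Con_refl[OF C(3)]
  let ?p = "component (False, False)" and ?q = "component (False, True)"
  let ?r = "component (True, False)" and ?s = "component (True, True)"
  define x y z u :: "('f, 'a + nat) trm set" where "x = code (matrix e e a a)" and "y = code (matrix e e e e)"
    and "z = code (matrix e c e c)" and "u = code (matrix c c a a)"
  have da: "(d, a) \<in> \<phi>"
    using ed ea Con_sym[OF C(1)] Con_trans[OF C(1)] by blast
  have cd: "(c, d) \<in> \<psi>"
    using dc Con_sym[OF C(2)] by blast
  have "matrix e e a a \<in> ?D" "matrix e e e e \<in> ?D" "matrix e c e c \<in> ?D" "matrix c c a a \<in> ?D"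
    unfolding centrality_matrices_def using car ea ec da cd by (blast intro: refl)+
  then have xyzu: "x \<in> carrier ?B" "y \<in> carrier ?B" "z \<in> carrier ?B" "u \<in> carrier ?B"
    unfolding carB x_def y_def z_def u_def by auto
  let ?Id = "Id_on (carrier A)"
  define \<gamma> where "\<gamma> = pullback ?B ?s \<beta>"
  define \<rho> where "\<rho> = pullback ?B ?p ?Id \<inter> \<gamma>"
  define \<sigma> where "\<sigma> = pullback ?B ?q ?Id"
  have pull: "pullback ?B (component i) \<theta> \<in> Con ?B" if "\<theta> \<in> Con A" for i :: "bool \<times> bool" and \<theta>
    by (rule pullback_Con[OF B(1) arB B(2) that])
  have \<gamma>: "\<gamma> \<in> Con ?B" and \<sigma>: "\<sigma> \<in> Con ?B" and \<rho>: "\<rho> \<in> Con ?B"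
    unfolding \<gamma>_def \<sigma>_def \<rho>_def by (intro Con_Int[OF B(1)] pull C(3) Con_Id[OF A])+
  have law: "Con_join ?B \<rho> (\<sigma> \<inter> \<gamma>) = Con_join ?B \<rho> \<sigma> \<inter> \<gamma>"
    by (rule modular_law[OF B(3)[OF gen] \<rho> \<sigma> \<gamma>]) (simp add: \<rho>_def)
  have xy: "(x, y) \<in> \<sigma>" and yz: "(y, z) \<in> \<rho>" and zu: "(z, u) \<in> \<sigma>" and xu: "(x, u) \<in> \<gamma>"
    using xyzu car ec refl
    by (auto simp: \<sigma>_def \<rho>_def \<gamma>_def pullback_def x_def y_def z_def u_def)
  have "(x, u) \<in> Con_join ?B \<rho> \<sigma>"
    using xy yz zu Con_join_in_Con(1-3)[OF B(1) \<rho> \<sigma>] by (blast intro: Con_trans)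
  with xu law have "(x, u) \<in> Con_join ?B \<rho> (\<sigma> \<inter> \<gamma>)"
    by simp
  then have chain: "(x, u) \<in> (\<rho> \<union> (\<sigma> \<inter> \<gamma>))\<^sup>+"
    using Con_join_trancl[OF B(1) \<rho> Con_Int[OF B(1) \<sigma> \<gamma>]] by blast
  have row: "(?p w, ?q w) \<in> \<phi>" if w: "w \<in> carrier ?B" and ws: "(a, ?s w) \<in> \<beta>" for w
  proof -
    obtain p q r s m n where w: "w = code (matrix p q r s)" and
      pq: "(p, q) \<in> \<beta>" and rs: "(r, s) \<in> \<beta>" and mn: "(m, n) \<in> \<beta>" and
      links: "(p, m) \<in> \<psi>" "(q, n) \<in> \<psi>" "(m, r) \<in> \<phi>" "(n, s) \<in> \<phi>"
      using w[unfolded carB] unfolding centrality_matrices_def by blast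
    have as: "(a, s) \<in> \<beta>"
      using ws w by simp
    then have "(a, r) \<in> \<beta>"
      using rs Con_sym[OF C(3)] Con_trans[OF C(3)] by blast
    with as have "(r, s) \<in> \<phi>"
      using trivial Con_sym[OF C(1)] Con_trans[OF C(1)] by blast
    then have "(m, n) \<in> \<phi>"
      using links(3,4) Con_sym[OF C(1)] Con_trans[OF C(1)] by blast
    then have "(m, n) \<in> \<psi>"
      using mn eq by blast
    then have "(p, q) \<in> \<psi>"
      using links(1,2) Con_sym[OF C(2)] Con_trans[OF C(2)] by blast
    then show ?thesis
      using pq eq w by auto
  qed
  have "w \<in> carrier ?B \<and> (a, ?s w) \<in> \<beta> \<and> (e, ?p w) \<in> \<phi>" if "(x, w) \<in> (\<rho> \<union> (\<sigma> \<inter> \<gamma>))\<^sup>*" for w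
    using that
  proof (induction rule: rtrancl_induct)
    case base
    show ?case
      using xyzu car refl by (simp add: x_def)
  next
    case (step v w)
    have "(v, w) \<in> \<gamma>"
      using step(2) by (auto simp: \<rho>_def)
    then have w: "w \<in> carrier ?B" and sw: "(a, ?s w) \<in> \<beta>"
      using step.IH by (auto simp: \<gamma>_def pullback_def intro: Con_trans[OF C(3)])
    from step(2) consider "?p v = ?p w" | "?q v = ?q w"
      by (auto simp: \<rho>_def \<sigma>_def pullback_def)
    then have "(e, ?p w) \<in> \<phi>"
    proof cases
      case 2
      have "(?p v, ?q w) \<in> \<phi>" "(?p w, ?q w) \<in> \<phi>"
        using row[of v] row[OF w sw] step.IH 2 by auto
      with step.IH show ?thesis
        using Con_sym[OF C(1)] Con_trans[OF C(1)] by blast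
    qed (use step.IH in simp)
    with w sw show ?case by blast
  qed
  from this[of u] chain show ?thesis
    by (auto simp: u_def dest: trancl_into_rtrancl)
qed

section \<open>Quotients of a strongly Fregean algebra\<close>

definition representative :: "'a set \<Rightarrow> 'a" where
  "representative X = (SOME x. x \<in> X)"

definition quotient_algebra :: "('a, 'f) ualg \<Rightarrow> 'a rel \<Rightarrow> ('a set, 'f) ualg" where
  "quotient_algebra A \<theta> = \<lparr>carrier = carrier A // \<theta>, arity = arity A,
     opn = (\<lambda>f Xs. \<theta> `` {opn A f (map representative Xs)})\<rparr>"

lemma quotient_algebra_sel:
  "carrier (quotient_algebra A \<theta>) = carrier A // \<theta>" "arity (quotient_algebra A \<theta>) = arity A"
  "opn (quotient_algebra A \<theta>) f Xs = \<theta> `` {opn A f (map representative Xs)}"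
  by (simp_all add: quotient_algebra_def)

lemma representative_class:
  assumes "\<theta> \<in> Con A" and "x \<in> carrier A"
  shows "(x, representative (\<theta> `` {x})) \<in> \<theta>"
proof -
  have "x \<in> \<theta> `` {x}"
    using Con_refl[OF assms] by simp
  then have "representative (\<theta> `` {x}) \<in> \<theta> `` {x}"
    unfolding representative_def by (rule someI)
  then show ?thesis by simp
qed

lemma representative_quotient:
  assumes "\<theta> \<in> Con A" and "X \<in> carrier A // \<theta>"
  shows "representative X \<in> carrier A" and "\<theta> `` {representative X} = X"
proof -
  obtain x where x: "x \<in> carrier A" "X = \<theta> `` {x}"
    using assms(2) by (rule quotientE)
  have r: "(x, representative X) \<in> \<theta>"
    unfolding x(2) by (rule representative_class[OF assms(1) x(1)])
  then show "representative X \<in> carrier A"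
    using Con_carrier[OF assms(1)] by auto
  from equiv_class_eq[OF Con_equiv[OF assms(1)] r] show "\<theta> `` {representative X} = X"
    using x(2) by simp
qed

lemma quotient_algebra_hom:
  assumes A: "universal_algebra A" and \<theta>: "\<theta> \<in> Con A"
  shows "universal_algebra (quotient_algebra A \<theta>)"
    and "alg_hom A (quotient_algebra A \<theta>) (\<lambda>x. \<theta> `` {x})"
    and "homomorphic_image A (quotient_algebra A \<theta>)"
proof -
  let ?Q = "quotient_algebra A \<theta>"
  have "\<theta> `` {opn A f (map representative Xs)} \<in> carrier A // \<theta>"
    if "length Xs = arity A f" and "set Xs \<subseteq> carrier A // \<theta>" for f Xs
  proof (rule quotientI, rule universal_algebra_opn[OF A])
    show "set (map representative Xs) \<subseteq> carrier A"
      using that(2) representative_quotient(1)[OF \<theta>] by auto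
  qed (use that(1) in simp)
  moreover have "carrier A // \<theta> \<noteq> {}"
    using A by (simp add: universal_algebra_def quotient_def)
  ultimately show Q: "universal_algebra ?Q"
    unfolding universal_algebra_def quotient_algebra_sel by blast
  show hom: "alg_hom A ?Q (\<lambda>x. \<theta> `` {x})"
    unfolding alg_hom_def quotient_algebra_sel
  proof (intro conjI allI impI funcsetI quotientI)
    fix f xs assume xs: "length xs = arity A f \<and> set xs \<subseteq> carrier A"
    then have "(opn A f (map (\<lambda>x. x) xs), opn A f (map (\<lambda>x. representative (\<theta> `` {x})) xs)) \<in> \<theta>"
      using representative_class[OF \<theta>] by (intro Con_opn_map[OF \<theta>]) auto
    then have "\<theta> `` {opn A f xs} = \<theta> `` {opn A f (map (\<lambda>x. representative (\<theta> `` {x})) xs)}"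
      by (intro equiv_class_eq[OF Con_equiv[OF \<theta>]]) simp
    then show "\<theta> `` {opn A f xs} = \<theta> `` {opn A f (map representative (map (\<lambda>x. \<theta> `` {x}) xs))}"
      by (simp add: comp_def)
  qed
  have "(\<lambda>x. \<theta> `` {x}) ` carrier A = carrier ?Q"
    unfolding quotient_algebra_sel quotient_def by auto
  with Q hom show "homomorphic_image A ?Q"
    unfolding homomorphic_image_def quotient_algebra_sel(2) by blast
qed

locale strongly_fregean_algebra =
  fixes A :: "('a, 'f) ualg" and t :: "('f, nat) trm"
  assumes strongly_fregean: "strongly_fregean A t"
begin

abbreviation "e \<equiv> const_value A t"

lemma A: "universal_algebra A"
  using strongly_fregean by (simp add: strongly_fregean_def)

lemma modular_variety: "generates_modular_variety A"
  using strongly_fregean by (simp add: strongly_fregean_def)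

lemma modular: "congruence_modular A"
  by (rule congruence_modular_self[OF A modular_variety])

lemma eval_constant:
  assumes "v \<in> UNIV \<rightarrow> carrier A"
  shows "eval_trm A v t = e"
proof -
  have same: "eval_trm A w t = eval_trm A v t" if "w \<in> UNIV \<rightarrow> carrier A" for w
  proof -
    have "constant_term A t"
      using strongly_fregean unfolding strongly_fregean_def by (elim conjE)
    then have "\<forall>v \<in> UNIV \<rightarrow> carrier A. \<forall>w \<in> UNIV \<rightarrow> carrier A. eval_trm A v t = eval_trm A w t"
      unfolding constant_term_def by (rule conjunct2)
    from bspec[OF bspec[OF this that] assms] show ?thesis .
  qed
  have "const_value A t = eval_trm A v t"
    unfolding const_value_def
  proof (rule the_equality)
    show "\<forall>w \<in> UNIV \<rightarrow> carrier A. eval_trm A w t = eval_trm A v t"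
      by (intro ballI same)
    show "c = eval_trm A v t" if "\<forall>w \<in> UNIV \<rightarrow> carrier A. eval_trm A w t = c" for c
      using bspec[OF that assms] by (rule sym)
  qed
  then show ?thesis by simp
qed

lemma wf_constant: "wf_trm (arity A) t"
  using strongly_fregean unfolding strongly_fregean_def constant_term_def by (elim conjE)

lemma e_carrier: "e \<in> carrier A"
proof -
  obtain x where "x \<in> carrier A"
    using A by (auto simp: universal_algebra_def)
  then have v: "(\<lambda>_. x) \<in> UNIV \<rightarrow> carrier A" by simp
  from eval_trm_closed[OF A v wf_constant] show ?thesis
    by (simp add: eval_constant[OF v])
qed

lemma const_value_quotient:
  assumes \<theta>: "\<theta> \<in> Con A"
  shows "const_value (quotient_algebra A \<theta>) t = \<theta> `` {e}"
proof -
  let ?Q = "quotient_algebra A \<theta>"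
  have eval: "eval_trm ?Q v t = \<theta> `` {e}" if v: "v \<in> UNIV \<rightarrow> carrier ?Q" for v
  proof -
    have w: "(\<lambda>i. representative (v i)) \<in> UNIV \<rightarrow> carrier A"
      using v representative_quotient(1)[OF \<theta>] by (auto simp: quotient_algebra_sel)
    have "(\<lambda>i. \<theta> `` {representative (v i)}) = v"
      using v representative_quotient(2)[OF \<theta>] by (auto simp: quotient_algebra_sel)
    then show ?thesis
      using alg_hom_eval_trm[OF A quotient_algebra_hom(2)[OF A \<theta>] w wf_constant]
      by (simp add: eval_constant[OF w])
  qed
  have v: "(\<lambda>_. \<theta> `` {e}) \<in> UNIV \<rightarrow> carrier ?Q"
    by (simp add: quotient_algebra_sel quotientI e_carrier)
  show ?thesis
    unfolding const_value_def[of ?Q]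
  proof (rule the_equality)
    show "\<forall>w \<in> UNIV \<rightarrow> carrier ?Q. eval_trm ?Q w t = \<theta> `` {e}"
      by (intro ballI eval)
    show "c = \<theta> `` {e}" if "\<forall>w \<in> UNIV \<rightarrow> carrier ?Q. eval_trm ?Q w t = c" for c
      using bspec[OF that v] eval[OF v] by (rule trans[OF sym])
  qed
qed

lemma quotient_fregean:
  assumes "\<theta> \<in> Con A"
  shows "congruence_orderable (quotient_algebra A \<theta>) (\<theta> `` {e})"
    and "point_regular (quotient_algebra A \<theta>) (\<theta> `` {e})"
  using strongly_fregean quotient_algebra_hom(3)[OF A assms]
  unfolding strongly_fregean_def fregean_def by (auto simp: const_value_quotient[OF assms])

text \<open>Congruence orderability of \<open>A/\<theta>\<close>, read in \<open>A\<close>: the congruences \<open>\<kappa>\<close> above \<open>\<theta>\<close> that contain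
  \<open>(e, x)\<close> stand for the congruences of \<open>A/\<theta>\<close> above the principal one.\<close>

lemma orderable:
  assumes \<theta>: "\<theta> \<in> Con A" and xy: "x \<in> carrier A" "y \<in> carrier A"
    and same: "\<And>\<kappa>. \<kappa> \<in> Con A \<Longrightarrow> \<theta> \<subseteq> \<kappa> \<Longrightarrow> (e, x) \<in> \<kappa> \<longleftrightarrow> (e, y) \<in> \<kappa>"
  shows "(x, y) \<in> \<theta>"
proof -
  let ?Q = "quotient_algebra A \<theta>" and ?c = "\<lambda>x. \<theta> `` {x}"
  have Q: "universal_algebra ?Q" and hom: "alg_hom A ?Q ?c" and ar: "arity ?Q = arity A"
    using quotient_algebra_hom[OF A \<theta>] by (simp_all add: quotient_algebra_sel)
  have car: "?c x \<in> carrier ?Q" if "x \<in> carrier A" for x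
    using that by (simp add: quotient_algebra_sel quotientI)
  have "Cg ?Q (?c e) (?c y) \<subseteq> Cg ?Q (?c e) (?c x)"
    if xy: "x \<in> carrier A" "y \<in> carrier A"
      and same: "\<And>\<kappa>. \<kappa> \<in> Con A \<Longrightarrow> \<theta> \<subseteq> \<kappa> \<Longrightarrow> (e, x) \<in> \<kappa> \<longleftrightarrow> (e, y) \<in> \<kappa>" for x y
  proof -
    let ?\<kappa> = "pullback A ?c (Cg ?Q (?c e) (?c x))"
    note Cg = Cg_in_Con[OF Q car[OF e_carrier] car[OF xy(1)]]
    have "\<theta> \<subseteq> ?\<kappa>"
    proof (rule subrelI)
      fix u v assume uv: "(u, v) \<in> \<theta>"
      then have c: "u \<in> carrier A" "v \<in> carrier A"
        using Con_carrier[OF \<theta>] by auto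
      have "?c u = ?c v"
        using uv by (rule equiv_class_eq[OF Con_equiv[OF \<theta>]])
      with c show "(u, v) \<in> ?\<kappa>"
        using Con_refl[OF Cg(1) car[OF c(2)]] by (simp add: pullback_def)
    qed
    moreover have "(e, x) \<in> ?\<kappa>"
      using e_carrier xy Cg(2) by (simp add: pullback_def)
    ultimately have "(e, y) \<in> ?\<kappa>"
      using same[OF pullback_Con[OF A ar hom Cg(1)]] by blast
    then have "(?c e, ?c y) \<in> Cg ?Q (?c e) (?c x)"
      by (simp add: pullback_def)
    then show ?thesis
      by (rule Cg_in_Con(3)[OF Q car[OF e_carrier] car[OF xy(2)] Cg(1)])
  qed
  from this[OF xy same] this[OF xy(2,1) same[symmetric]]
  have "Cg ?Q (?c e) (?c x) = Cg ?Q (?c e) (?c y)"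
    by (intro equalityI)
  then have "?c x = ?c y"
    using quotient_fregean(1)[OF \<theta>] car[OF xy(1)] car[OF xy(2)]
    unfolding congruence_orderable_def by blast
  then show ?thesis
    by (rule eq_equiv_class[OF _ Con_equiv[OF \<theta>] xy(2)])
qed

text \<open>Point regularity is given for the homomorphic images, and the quotient by the identity is a
  copy of \<open>A\<close> among them.\<close>

lemma regular:
  assumes \<alpha>: "\<alpha> \<in> Con A" and \<beta>: "\<beta> \<in> Con A" and same: "\<And>x. (e, x) \<in> \<alpha> \<longleftrightarrow> (e, x) \<in> \<beta>"
  shows "\<alpha> = \<beta>"
proof -
  let ?I = "Id_on (carrier A)"
  let ?Q = "quotient_algebra A ?I"
  note I = Con_Id[OF A]
  have rep: "representative (?I `` {x}) = x" if "x \<in> carrier A" for x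
    using representative_class[OF I that] by (auto elim: Id_onE)
  have Q: "universal_algebra ?Q" and ar: "arity A = arity ?Q"
    using quotient_algebra_hom[OF A I] by (simp_all add: quotient_algebra_sel)
  have hom: "alg_hom ?Q A representative"
    unfolding alg_hom_def quotient_algebra_sel
  proof (intro conjI allI impI funcsetI representative_quotient(1)[OF I])
    fix f Xs assume "length Xs = arity A f \<and> set Xs \<subseteq> carrier A // ?I"
    then have "opn A f (map representative Xs) \<in> carrier A"
      using representative_quotient(1)[OF I] by (intro universal_algebra_opn[OF A]) auto
    then show "representative (?I `` {opn A f (map representative Xs)}) = opn A f (map representative Xs)"
      by (rule rep)
  qed
  let ?p = "pullback ?Q representative"
  have "?p \<alpha> `` {?I `` {e}} = ?p \<beta> `` {?I `` {e}}"
    by (rule Set.set_eqI)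
      (simp only: Image_singleton_iff pullback_def mem_Collect_eq prod.case rep[OF e_carrier] same)
  then have eq: "?p \<alpha> = ?p \<beta>"
    using quotient_fregean(2)[OF I] pullback_Con[OF Q ar hom \<alpha>] pullback_Con[OF Q ar hom \<beta>]
    unfolding point_regular_def by blast
  have member: "(x, y) \<in> \<theta> \<longleftrightarrow> (?I `` {x}, ?I `` {y}) \<in> ?p \<theta>"
    if "x \<in> carrier A" "y \<in> carrier A" for x y \<theta>
    using that by (simp only: pullback_def quotient_algebra_sel quotientI rep mem_Collect_eq prod.case simp_thms)
  have "(x, y) \<in> \<alpha> \<longleftrightarrow> (x, y) \<in> \<beta>" if "x \<in> carrier A" "y \<in> carrier A" for x y
    by (simp only: member[OF that] eq)
  then show ?thesis
    using Con_carrier[OF \<alpha>] Con_carrier[OF \<beta>] by (intro equalityI subrelI) auto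
qed

lemma regular_witness:
  assumes "\<alpha> \<in> Con A" and "\<beta> \<in> Con A" and "\<not> \<alpha> \<subseteq> \<beta>"
  obtains x where "(e, x) \<in> \<alpha>" and "(e, x) \<notin> \<beta>"
  using regular[OF Con_Int[OF A assms(1,2)] assms(1)] assms(3) by blast

lemmas in_join = Con_join_in_Con[OF A]
lemmas cover_Con = cover_props(1)[OF A]
lemmas cover_greater = cover_props(2)[OF A]
lemmas cover_least = cover_props(3)[OF A]

text \<open>In \<open>A/\<phi>\<close> every nontrivial congruence contains the monolith \<open>\<phi>\<^sup>+/\<phi>\<close>. Two elements identified
  by the monolith are thus told apart from \<open>1\<close> by the same nontrivial congruences, and
  orderability makes them equal unless exactly one of them is \<open>1\<close>. So the monolith has a single
  nontrivial class \<open>{1, *}\<close>: the passage from \<open>\<phi>\<^sup>+\<close> to \<open>\<phi>\<close> only splits the class of \<open>e\<close>, into two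
  halves.\<close>

lemma cover_iff:
  assumes \<phi>: "\<phi> \<in> Cm A" and xy: "(x, y) \<in> cover A \<phi>"
  shows "(x, y) \<in> \<phi> \<longleftrightarrow> ((e, x) \<in> \<phi> \<longleftrightarrow> (e, y) \<in> \<phi>)"
proof
  show "(e, x) \<in> \<phi> \<longleftrightarrow> (e, y) \<in> \<phi>" if "(x, y) \<in> \<phi>"
    using that Con_sym[OF Cm_Con[OF \<phi>]] Con_trans[OF Cm_Con[OF \<phi>]] by blast
  assume same: "(e, x) \<in> \<phi> \<longleftrightarrow> (e, y) \<in> \<phi>"
  show "(x, y) \<in> \<phi>"
  proof (rule orderable[OF Cm_Con[OF \<phi>]])
    show "x \<in> carrier A" "y \<in> carrier A"
      using xy Con_carrier[OF cover_Con[OF \<phi>]] by auto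
    fix \<kappa> assume \<kappa>: "\<kappa> \<in> Con A" "\<phi> \<subseteq> \<kappa>"
    show "(e, x) \<in> \<kappa> \<longleftrightarrow> (e, y) \<in> \<kappa>"
    proof (cases "\<kappa> = \<phi>")
      case False
      with \<kappa> have "(x, y) \<in> \<kappa>"
        using cover_least[OF \<phi> \<kappa>(1)] xy by blast
      then show ?thesis
        using Con_sym[OF \<kappa>(1)] Con_trans[OF \<kappa>(1)] by blast
    qed (use same in simp)
  qed
qed

lemma cover_diff_unit:
  assumes \<phi>: "\<phi> \<in> Cm A" and "(x, y) \<in> cover A \<phi>" and "(x, y) \<notin> \<phi>"
  shows "(e, x) \<in> cover A \<phi>"
proof -
  have "(e, x) \<in> cover A \<phi> \<or> (e, y) \<in> cover A \<phi>"
    using cover_iff[OF assms(1,2)] assms(3) cover_greater[OF \<phi>] by blast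
  then show ?thesis
    using assms(2) Con_sym[OF cover_Con[OF \<phi>]] Con_trans[OF cover_Con[OF \<phi>]] by blast
qed

text \<open>With only two halves, being separated by \<open>\<phi>\<close> is additive modulo \<open>2\<close>.\<close>

lemma cover_parity:
  assumes \<phi>: "\<phi> \<in> Cm A" and xy: "(x, y) \<in> cover A \<phi>" and yz: "(y, z) \<in> cover A \<phi>"
  shows "(x, z) \<in> \<phi> \<longleftrightarrow> ((x, y) \<in> \<phi> \<longleftrightarrow> (y, z) \<in> \<phi>)"
  using cover_iff[OF \<phi> xy] cover_iff[OF \<phi> yz] cover_iff[OF \<phi> Con_trans[OF cover_Con[OF \<phi>] xy yz]]
  by blast

end

section \<open>Projective prime intervals\<close>

lemma transposes_up_iff:
  "((\<alpha>, \<beta>), (\<gamma>, \<delta>)) \<in> transposes_up A \<longleftrightarrow> \<alpha> \<in> Con A \<and> \<beta> \<in> Con A \<and> \<gamma> \<in> Con A \<and> \<delta> \<in> Con A \<and>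
     \<alpha> \<subseteq> \<beta> \<and> \<gamma> \<subseteq> \<delta> \<and> \<beta> \<inter> \<gamma> = \<alpha> \<and> Con_join A \<beta> \<gamma> = \<delta>"
  unfolding transposes_up_def by auto

definition prime_interval :: "('a, 'f) ualg \<Rightarrow> 'a rel \<times> 'a rel \<Rightarrow> bool" where
  "prime_interval A I \<longleftrightarrow> fst I \<in> Con A \<and> snd I \<in> Con A \<and> fst I \<subset> snd I \<and>
     (\<forall>\<theta>\<in>Con A. fst I \<subseteq> \<theta> \<and> \<theta> \<subseteq> snd I \<longrightarrow> \<theta> = fst I \<or> \<theta> = snd I)"

lemma transposes_up_trans:
  assumes A: "universal_algebra A"
    and IJ: "((\<alpha>, \<beta>), (\<gamma>, \<delta>)) \<in> transposes_up A" and JK: "((\<gamma>, \<delta>), (\<epsilon>, \<zeta>)) \<in> transposes_up A"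
  shows "((\<alpha>, \<beta>), (\<epsilon>, \<zeta>)) \<in> transposes_up A"
proof -
  note IJ = IJ[unfolded transposes_up_iff] and JK = JK[unfolded transposes_up_iff]
  have C: "\<alpha> \<in> Con A" "\<beta> \<in> Con A" "\<gamma> \<in> Con A" "\<delta> \<in> Con A" "\<epsilon> \<in> Con A" "\<zeta> \<in> Con A"
    using IJ JK by auto
  have \<beta>\<delta>: "\<beta> \<subseteq> \<delta>" and \<delta>\<zeta>: "\<delta> \<subseteq> \<zeta>" and \<epsilon>\<zeta>: "\<epsilon> \<subseteq> \<zeta>" and \<gamma>\<epsilon>: "\<gamma> \<subseteq> \<epsilon>"
    using IJ JK Con_join_in_Con(2,3)[OF A C(2,3)] Con_join_in_Con(2,3)[OF A C(4,5)] by auto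
  have meet: "\<beta> \<inter> \<epsilon> = \<alpha>"
  proof -
    have "\<beta> \<inter> \<epsilon> = \<beta> \<inter> (\<delta> \<inter> \<epsilon>)"
      using \<beta>\<delta> by blast
    then show ?thesis
      using IJ JK by simp
  qed
  note j = Con_join_in_Con[OF A C(2,5)]
  have "\<delta> \<subseteq> Con_join A \<beta> \<epsilon>"
  proof -
    have "Con_join A \<beta> \<gamma> \<subseteq> Con_join A \<beta> \<epsilon>"
      using j \<gamma>\<epsilon> by (intro Con_join_in_Con(4)[OF A C(2,3)]) auto
    then show ?thesis using IJ by simp
  qed
  then have "Con_join A \<delta> \<epsilon> \<subseteq> Con_join A \<beta> \<epsilon>"
    using j by (intro Con_join_in_Con(4)[OF A C(4,5)]) auto
  moreover have "Con_join A \<beta> \<epsilon> \<subseteq> \<zeta>"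
    using \<beta>\<delta> \<delta>\<zeta> \<epsilon>\<zeta> by (intro j(4) C(6)) auto
  ultimately have "Con_join A \<beta> \<epsilon> = \<zeta>"
    using JK by auto
  with C meet \<epsilon>\<zeta> IJ show ?thesis
    unfolding transposes_up_iff by blast
qed

text \<open>In a modular lattice, meet with \<open>\<beta>\<close> and join with \<open>\<gamma>\<close> are mutually inverse isomorphisms
  between \<open>I[\<gamma>, \<delta>]\<close> and \<open>I[\<alpha>, \<beta>]\<close>. The next two lemmas use one half of this each.\<close>

lemma prime_interval_up:
  assumes A: "universal_algebra A" and M: "congruence_modular A"
    and tr: "((\<alpha>, \<beta>), (\<gamma>, \<delta>)) \<in> transposes_up A" and prime: "prime_interval A (\<alpha>, \<beta>)"
  shows "prime_interval A (\<gamma>, \<delta>)"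
proof -
  note tr = tr[unfolded transposes_up_iff]
  have C: "\<alpha> \<in> Con A" "\<beta> \<in> Con A" "\<gamma> \<in> Con A" "\<delta> \<in> Con A" and le: "\<gamma> \<subseteq> \<delta>"
    and meet: "\<beta> \<inter> \<gamma> = \<alpha>" and join: "Con_join A \<beta> \<gamma> = \<delta>"
    using tr by auto
  have ab: "\<alpha> \<subset> \<beta>"
    using prime by (simp add: prime_interval_def)
  note j = Con_join_in_Con[OF A C(3,2)]
  have join': "Con_join A \<gamma> \<beta> = \<delta>"
    using join j Con_join_in_Con[OF A C(2,3)] by (intro equalityI) auto
  have "\<theta> = \<gamma> \<or> \<theta> = \<delta>" if \<theta>: "\<theta> \<in> Con A" "\<gamma> \<subseteq> \<theta>" "\<theta> \<subseteq> \<delta>" for \<theta>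
  proof -
    have law: "Con_join A \<gamma> (\<beta> \<inter> \<theta>) = \<theta>"
      using modular_law[OF M C(3) C(2) \<theta>(1,2)] join' \<theta>(3) by auto
    have "\<alpha> \<subseteq> \<beta> \<inter> \<theta>" "\<beta> \<inter> \<theta> \<subseteq> \<beta>"
      using meet \<theta>(2) by auto
    then have "\<beta> \<inter> \<theta> = \<alpha> \<or> \<beta> \<inter> \<theta> = \<beta>"
      using prime Con_Int[OF A C(2) \<theta>(1)] by (simp add: prime_interval_def)
    then show ?thesis
    proof
      assume eq: "\<beta> \<inter> \<theta> = \<alpha>"
      have "Con_join A \<gamma> \<alpha> \<subseteq> \<gamma>"
        using meet by (intro Con_join_in_Con(4)[OF A C(3,1,3)]) auto
      with law eq \<theta>(2) show ?thesis by auto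
    next
      assume "\<beta> \<inter> \<theta> = \<beta>"
      with law join' show ?thesis by auto
    qed
  qed
  moreover have "\<gamma> \<noteq> \<delta>"
    using j(3) join' meet ab by auto
  ultimately show ?thesis
    using C le by (auto simp: prime_interval_def)
qed

lemma prime_interval_down:
  assumes A: "universal_algebra A" and M: "congruence_modular A"
    and tr: "((\<alpha>, \<beta>), (\<gamma>, \<delta>)) \<in> transposes_up A" and prime: "prime_interval A (\<gamma>, \<delta>)"
  shows "prime_interval A (\<alpha>, \<beta>)"
proof -
  note tr = tr[unfolded transposes_up_iff]
  have C: "\<alpha> \<in> Con A" "\<beta> \<in> Con A" "\<gamma> \<in> Con A" "\<delta> \<in> Con A" and le: "\<alpha> \<subseteq> \<beta>"
    and meet: "\<beta> \<inter> \<gamma> = \<alpha>" and join: "Con_join A \<beta> \<gamma> = \<delta>"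
    using tr by auto
  have cd: "\<gamma> \<subset> \<delta>"
    using prime by (simp add: prime_interval_def)
  have "\<theta> = \<alpha> \<or> \<theta> = \<beta>" if \<theta>: "\<theta> \<in> Con A" "\<alpha> \<subseteq> \<theta>" "\<theta> \<subseteq> \<beta>" for \<theta>
  proof -
    note j = Con_join_in_Con[OF A \<theta>(1) C(3)]
    have "Con_join A \<theta> \<alpha> = \<theta>"
      using Con_join_in_Con(2)[OF A \<theta>(1) C(1)] Con_join_in_Con(4)[OF A \<theta>(1) C(1) \<theta>(1)] \<theta>(2)
      by auto
    then have law: "\<theta> = Con_join A \<theta> \<gamma> \<inter> \<beta>"
      using modular_law[OF M \<theta>(1) C(3,2) \<theta>(3)] meet by (simp add: Int_commute)
    have "Con_join A \<theta> \<gamma> \<subseteq> \<delta>"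
      using join Con_join_in_Con(2,3)[OF A C(2,3)] \<theta>(3) by (intro j(4) C(4)) auto
    then have "Con_join A \<theta> \<gamma> = \<gamma> \<or> Con_join A \<theta> \<gamma> = \<delta>"
      using prime j(1,3) by (simp add: prime_interval_def)
    then show ?thesis
    proof
      assume "Con_join A \<theta> \<gamma> = \<gamma>"
      with law meet show ?thesis by auto
    next
      assume "Con_join A \<theta> \<gamma> = \<delta>"
      moreover have "\<beta> \<subseteq> \<delta>"
        using join Con_join_in_Con(2)[OF A C(2,3)] by simp
      ultimately show ?thesis using law by auto
    qed
  qed
  moreover have "\<alpha> \<noteq> \<beta>"
  proof
    assume "\<alpha> = \<beta>"
    then have "Con_join A \<beta> \<gamma> \<subseteq> \<gamma>"
      using meet by (intro Con_join_in_Con(4)[OF A C(2,3,3)]) auto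
    with join cd show False by auto
  qed
  ultimately show ?thesis
    using C le by (auto simp: prime_interval_def)
qed

lemma prime_interval_cover:
  assumes A: "universal_algebra A" and \<phi>: "\<phi> \<in> Cm A"
  shows "prime_interval A (\<phi>, cover A \<phi>)"
proof -
  have "\<theta> = \<phi> \<or> \<theta> = cover A \<phi>" if "\<theta> \<in> Con A" "\<phi> \<subseteq> \<theta>" "\<theta> \<subseteq> cover A \<phi>" for \<theta>
    using cover_props(3)[OF A \<phi> that(1)] that(2,3) by blast
  then show ?thesis
    using cover_props(1,2)[OF A \<phi>] Cm_Con[OF \<phi>] by (auto simp: prime_interval_def)
qed

lemma transposes_up_cover_refl:
  assumes A: "universal_algebra A" and \<phi>: "\<phi> \<in> Cm A"
  shows "((\<phi>, cover A \<phi>), (\<phi>, cover A \<phi>)) \<in> transposes_up A"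
proof -
  note c = cover_props[OF A \<phi>]
  have "Con_join A (cover A \<phi>) \<phi> = cover A \<phi>"
    using Con_join_in_Con(2)[OF A c(1) Cm_Con[OF \<phi>]] c(2)
      Con_join_in_Con(4)[OF A c(1) Cm_Con[OF \<phi>] c(1)] by auto
  then show ?thesis
    unfolding transposes_up_iff using c(1,2) Cm_Con[OF \<phi>] by auto
qed

text \<open>If \<open>(x, y)\<close> lies in \<open>\<delta>\<close> but not in \<open>\<gamma>\<close>, a congruence maximal among those above \<open>\<gamma>\<close> that omit
  \<open>(x, y)\<close> meets \<open>\<delta>\<close> in \<open>\<gamma>\<close>, and its cover contains \<open>\<delta>\<close>, as there is nothing between \<open>\<gamma>\<close> and
  \<open>\<delta>\<close>. In this way the intervals of a projectivity are replaced by those of completely meet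
  irreducible congruences.\<close>

lemma prime_interval_transposes_to_cover:
  assumes A: "universal_algebra A" and prime: "prime_interval A (\<gamma>, \<delta>)"
  obtains \<mu> where "\<mu> \<in> Cm A" and "((\<gamma>, \<delta>), (\<mu>, cover A \<mu>)) \<in> transposes_up A"
proof -
  have C: "\<gamma> \<in> Con A" "\<delta> \<in> Con A" and less: "\<gamma> \<subset> \<delta>"
    and between: "\<And>\<theta>. \<theta> \<in> Con A \<Longrightarrow> \<gamma> \<subseteq> \<theta> \<Longrightarrow> \<theta> \<subseteq> \<delta> \<Longrightarrow> \<theta> = \<gamma> \<or> \<theta> = \<delta>"
    using prime by (auto simp: prime_interval_def)
  obtain x y where xy: "(x, y) \<in> \<delta>" "(x, y) \<notin> \<gamma>"
    using less by auto
  then have car: "x \<in> carrier A" "y \<in> carrier A"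
    using Con_carrier[OF C(2)] by auto
  obtain \<mu> where \<mu>: "\<mu> \<in> Cm A" "\<gamma> \<subseteq> \<mu>" "(x, y) \<notin> \<mu>"
    and max: "\<And>\<kappa>. \<kappa> \<in> Con A \<Longrightarrow> \<mu> \<subset> \<kappa> \<Longrightarrow> (x, y) \<in> \<kappa>"
    using Cm_separates[OF C(1) xy(2) car] by blast
  note c = cover_props[OF A \<mu>(1)] and M = Cm_Con[OF \<mu>(1)]
  note j = Con_join_in_Con[OF A C(2) M]
  have meet: "\<delta> \<inter> \<mu> = \<gamma>"
    using between[OF Con_Int[OF A C(2) M]] \<mu>(2,3) xy less by blast
  have "\<delta> \<inter> cover A \<mu> = \<delta>"
    using between[OF Con_Int[OF A C(2) c(1)]] max[OF c(1,2)] \<mu>(2) c(2) xy less by blast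
  then have "Con_join A \<delta> \<mu> \<subseteq> cover A \<mu>"
    using c(2) by (intro j(4) c(1)) auto
  moreover have "cover A \<mu> \<subseteq> Con_join A \<delta> \<mu>"
    using j(2,3) \<mu>(3) xy(1) by (intro c(3) j(1)) auto
  ultimately have "((\<gamma>, \<delta>), (\<mu>, cover A \<mu>)) \<in> transposes_up A"
    unfolding transposes_up_iff using C M c(1,2) meet less by auto
  with \<mu>(1) that show ?thesis by blast
qed

lemma equiv_Cm_sim: "equiv (Cm A) (Cm_sim A)"
proof (rule equivI)
  have "sym (projective A)"
    unfolding projective_def by (intro sym_rtrancl sym_Un_converse)
  then show "sym (Cm_sim A)"
    unfolding Cm_sim_def by (auto simp: sym_def)
  have "trans (projective A)"
    unfolding projective_def by (rule trans_rtrancl)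
  then show "trans (Cm_sim A)"
    unfolding Cm_sim_def trans_def by blast
  show "refl_on (Cm A) (Cm_sim A)"
    by (auto simp: refl_on_def Cm_sim_def projective_def)
qed (auto simp: Cm_sim_def)

section \<open>Similarity along projectivities\<close>

context strongly_fregean_algebra
begin

definition collapses :: "'a rel \<Rightarrow> ('a \<Rightarrow> 'a) \<Rightarrow> bool" where
  "collapses \<phi> s \<longleftrightarrow> (\<exists>x y. (x, y) \<in> cover A \<phi> - \<phi> \<and> (s x, s y) \<in> \<phi>)"

text \<open>Two conditions make \<open>\<phi> \<bullet> \<psi>\<close> a congruence: the covers coincide, and a translation collapses the
  two halves of \<open>\<phi>\<close> exactly if it collapses those of \<open>\<psi>\<close>. In this form they define an equivalence
  relation, which can be carried along a projectivity step by step.\<close>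

definition similar :: "'a rel \<Rightarrow> 'a rel \<Rightarrow> bool" where
  "similar \<phi> \<psi> \<longleftrightarrow> cover A \<phi> = cover A \<psi> \<and>
     (\<forall>s\<in>elementary_translations A. collapses \<phi> s \<longleftrightarrow> collapses \<psi> s)"

text \<open>Any two pairs separated by \<open>\<phi>\<close> inside \<open>\<phi>\<^sup>+\<close> connect the same two classes of \<open>\<phi>\<close>, so one
  witness decides for all.\<close>

lemma collapses_iff:
  assumes \<phi>: "\<phi> \<in> Cm A" and s: "s \<in> elementary_translations A"
    and xy: "(x, y) \<in> cover A \<phi>" "(x, y) \<notin> \<phi>"
  shows "(s x, s y) \<in> \<phi> \<longleftrightarrow> collapses \<phi> s"
proof
  show "collapses \<phi> s" if "(s x, s y) \<in> \<phi>"
    using that xy unfolding collapses_def by blast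
  assume "collapses \<phi> s"
  then obtain x' y' where xy': "(x', y') \<in> cover A \<phi>" "(x', y') \<notin> \<phi>" and s': "(s x', s y') \<in> \<phi>"
    unfolding collapses_def by blast
  note P = Cm_Con[OF \<phi>] and Q = cover_Con[OF \<phi>]
  note S = Con_translation[OF P s]
  have xx': "(x, x') \<in> cover A \<phi>"
    using cover_diff_unit[OF \<phi> xy] cover_diff_unit[OF \<phi> xy'] Con_sym[OF Q] Con_trans[OF Q] by blast
  have yx': "(y, x') \<in> cover A \<phi>"
    using xx' xy(1) Con_sym[OF Q] Con_trans[OF Q] by blast
  show "(s x, s y) \<in> \<phi>"
  proof (cases "(x, x') \<in> \<phi>")
    case True
    then have "(y, x') \<notin> \<phi>"
      using xy(2) Con_sym[OF P] Con_trans[OF P] by blast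
    then have "(y, y') \<in> \<phi>"
      using cover_parity[OF \<phi> yx' xy'(1)] xy'(2) by blast
    with True have "(s x, s x') \<in> \<phi>" "(s y', s y) \<in> \<phi>"
      by (auto intro: S Con_sym[OF P])
    with s' show ?thesis
      using Con_trans[OF P] by blast
  next
    case False
    then have "(x, y') \<in> \<phi>" "(y, x') \<in> \<phi>"
      using cover_parity[OF \<phi> xx' xy'(1)] xy'(2) cover_parity[OF \<phi> Con_sym[OF Q xy(1)] xx']
        xy(2) Con_sym[OF P] by blast+
    then have "(s x, s y') \<in> \<phi>" "(s x', s y) \<in> \<phi>"
      by (auto intro: S Con_sym[OF P])
    with s' show ?thesis
      using Con_trans[OF P] Con_sym[OF P] by blast
  qed
qed

lemma transpose_not_below:
  assumes \<phi>: "\<phi> \<in> Cm A" and tr: "((\<alpha>, \<beta>), (\<phi>, cover A \<phi>)) \<in> transposes_up A"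
  shows "\<not> \<beta> \<subseteq> \<phi>" and "\<beta> \<subseteq> cover A \<phi>"
proof -
  note tr = tr[unfolded transposes_up_iff]
  have C: "\<beta> \<in> Con A" "\<phi> \<in> Con A" and join: "Con_join A \<beta> \<phi> = cover A \<phi>"
    using tr by auto
  show "\<not> \<beta> \<subseteq> \<phi>"
    using in_join(4)[OF C C(2)] join cover_greater[OF \<phi>] by auto
  show "\<beta> \<subseteq> cover A \<phi>"
    using in_join(2)[OF C] join by simp
qed

text \<open>This is where modularity of the whole variety enters. Suppose \<open>\<phi>\<^sup>+\<close> is not below \<open>\<psi>\<^sup>+\<close>. Then
  some \<open>a\<close> with \<open>(e, a) \<in> \<phi>\<close> lies outside the \<open>\<psi>\<^sup>+\<close>-class of \<open>e\<close>. Out there \<open>\<psi>\<close> and \<open>\<psi>\<^sup>+\<close> coincide,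
  and since \<open>\<beta> \<subseteq> \<psi>\<^sup>+\<close>, the \<open>\<beta>\<close>-class of \<open>a\<close> is trivial modulo \<open>\<alpha>\<close>. That of \<open>e\<close> is not, as witnessed by some \<open>c\<close>, against the
  fact that \<open>\<beta>\<close> is centralized modulo \<open>\<alpha>\<close>. The required connection from \<open>e\<close> to \<open>c\<close> by \<open>\<phi>\<close> and
  \<open>\<psi>\<close> goes through any \<open>d\<close> in the \<open>\<phi> \<inter> \<psi>\<^sup>+\<close>-class but not in the \<open>\<psi>\<close>-class of \<open>e\<close>, because \<open>c\<close>
  and \<open>d\<close> then lie in the same half for \<open>\<psi>\<close>.\<close>

lemma cover_le_of_common_transpose:
  assumes \<phi>: "\<phi> \<in> Cm A" and \<psi>: "\<psi> \<in> Cm A"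
    and tr\<phi>: "((\<alpha>, \<beta>), (\<phi>, cover A \<phi>)) \<in> transposes_up A"
    and tr\<psi>: "((\<alpha>, \<beta>), (\<psi>, cover A \<psi>)) \<in> transposes_up A"
  shows "cover A \<phi> \<subseteq> cover A \<psi>"
proof (rule ccontr)
  assume not_le: "\<not> cover A \<phi> \<subseteq> cover A \<psi>"
  note C\<phi> = Cm_Con[OF \<phi>] and C\<psi> = Cm_Con[OF \<psi>] and K\<psi> = cover_Con[OF \<psi>]
  have \<beta>: "\<beta> \<in> Con A" and join: "Con_join A \<beta> \<phi> = cover A \<phi>" and meet: "\<beta> \<inter> \<phi> = \<beta> \<inter> \<psi>"
    using tr\<phi> tr\<psi> unfolding transposes_up_iff by auto
  have \<beta>\<psi>: "\<beta> \<subseteq> cover A \<psi>"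
    by (rule transpose_not_below(2)[OF \<psi> tr\<psi>])
  have \<phi>_not_le: "\<not> \<phi> \<subseteq> cover A \<psi>"
    using in_join(4)[OF \<beta> C\<phi> K\<psi> \<beta>\<psi>] join not_le by auto
  (* Otherwise the modular law gives (\<psi> \<or> \<phi>) \<and> \<psi>\<^sup>+ = \<psi>, although \<psi> \<or> \<phi>, being properly
     above \<psi>, is above \<psi>\<^sup>+. *)
  have "\<not> \<phi> \<inter> cover A \<psi> \<subseteq> \<psi>"
  proof
    assume le: "\<phi> \<inter> cover A \<psi> \<subseteq> \<psi>"
    have "Con_join A \<psi> (\<phi> \<inter> cover A \<psi>) \<subseteq> \<psi>"
      by (rule in_join(4)[OF C\<psi> Con_Int[OF A C\<phi> K\<psi>] C\<psi> subset_refl le])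
    then have "Con_join A \<psi> \<phi> \<inter> cover A \<psi> \<subseteq> \<psi>"
      using modular_law[OF modular C\<psi> C\<phi> K\<psi>] cover_greater[OF \<psi>] by auto
    moreover have "cover A \<psi> \<subseteq> Con_join A \<psi> \<phi>"
      using in_join(2,3)[OF C\<psi> C\<phi>] \<phi>_not_le cover_greater[OF \<psi>]
      by (intro cover_least[OF \<psi> in_join(1)[OF C\<psi> C\<phi>]]) auto
    ultimately show False
      using cover_greater[OF \<psi>] by auto
  qed
  then obtain d where d: "(e, d) \<in> \<phi>" "(e, d) \<in> cover A \<psi>" "(e, d) \<notin> \<psi>"
    using regular_witness[OF Con_Int[OF A C\<phi> K\<psi>] C\<psi>] by blast
  obtain a where a: "(e, a) \<in> \<phi>" "(e, a) \<notin> cover A \<psi>"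
    using regular_witness[OF C\<phi> K\<psi> \<phi>_not_le] by blast
  obtain c where c: "(e, c) \<in> \<beta>" "(e, c) \<notin> \<phi>"
    using regular_witness[OF \<beta> C\<phi> transpose_not_below(1)[OF \<phi> tr\<phi>]] by blast
  have "(e, c) \<notin> \<psi>"
    using c meet by blast
  moreover have "(d, c) \<in> cover A \<psi>"
    using d(2) c(1) \<beta>\<psi> Con_sym[OF K\<psi>] Con_trans[OF K\<psi>] by blast
  ultimately have dc: "(d, c) \<in> \<psi>"
    using cover_iff[OF \<psi>] d(3) by blast
  have "(a, x) \<in> \<phi>" if "(a, x) \<in> \<beta>" for x
    using cover_diff_unit[OF \<psi>, of a x] that \<beta>\<psi> a(2) meet by blast
  from collapse_by_trivial_class[OF A modular_variety C\<phi> C\<psi> \<beta> meet c(1) d(1) dc a(1) this]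
  show False
    using c(2) by blast
qed

text \<open>A pair of \<open>\<beta>\<close> outside \<open>\<phi>\<close> is separated by \<open>\<phi>\<close> and by \<open>\<psi>\<close>, and its image stays in \<open>\<beta>\<close>, where
  \<open>\<phi>\<close> and \<open>\<psi>\<close> agree.\<close>

lemma collapses_of_common_transpose:
  assumes \<phi>: "\<phi> \<in> Cm A" and \<psi>: "\<psi> \<in> Cm A"
    and tr\<phi>: "((\<alpha>, \<beta>), (\<phi>, cover A \<phi>)) \<in> transposes_up A"
    and tr\<psi>: "((\<alpha>, \<beta>), (\<psi>, cover A \<psi>)) \<in> transposes_up A"
    and s: "s \<in> elementary_translations A" and coll: "collapses \<phi> s"
  shows "collapses \<psi> s"
proof -
  have \<beta>: "\<beta> \<in> Con A" and meet: "\<beta> \<inter> \<phi> = \<beta> \<inter> \<psi>"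
    using tr\<phi> tr\<psi> unfolding transposes_up_iff by auto
  obtain x y where xy: "(x, y) \<in> \<beta>" "(x, y) \<notin> \<phi>"
    using transpose_not_below(1)[OF \<phi> tr\<phi>] by auto
  then have "(s x, s y) \<in> \<phi>"
    using collapses_iff[OF \<phi> s, of x y] transpose_not_below(2)[OF \<phi> tr\<phi>] coll by blast
  then have "(s x, s y) \<in> \<psi>"
    using Con_translation[OF \<beta> s xy(1)] meet by blast
  moreover have "(x, y) \<in> cover A \<psi> - \<psi>"
    using xy meet transpose_not_below(2)[OF \<psi> tr\<psi>] by blast
  ultimately show ?thesis
    unfolding collapses_def by blast
qed

lemma similar_of_common_transpose:
  assumes "\<phi> \<in> Cm A" and "\<psi> \<in> Cm A"
    and "((\<alpha>, \<beta>), (\<phi>, cover A \<phi>)) \<in> transposes_up A"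
    and "((\<alpha>, \<beta>), (\<psi>, cover A \<psi>)) \<in> transposes_up A"
  shows "similar \<phi> \<psi>"
  unfolding similar_def
  using cover_le_of_common_transpose[OF assms] cover_le_of_common_transpose[OF assms(2,1,4,3)]
    collapses_of_common_transpose[OF assms] collapses_of_common_transpose[OF assms(2,1,4,3)]
  by blast

text \<open>An upward step leaves fewer \<open>\<mu>\<close> to consider. After a downward step from \<open>I\<close> to \<open>J\<close>, primality
  of \<open>I\<close> provides a completely meet irreducible \<open>\<nu>\<close> above \<open>I\<close>, which is similar to \<open>\<phi>\<close> by the
  induction hypothesis and shares the lower transpose \<open>J\<close> with every new \<open>\<mu>\<close>.\<close>

lemma projective_similar:
  assumes \<phi>: "\<phi> \<in> Cm A" and "((\<phi>, cover A \<phi>), J) \<in> projective A"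
  shows "prime_interval A J \<and>
    (\<forall>\<mu>\<in>Cm A. (J, (\<mu>, cover A \<mu>)) \<in> transposes_up A \<longrightarrow> similar \<phi> \<mu>)"
  using assms(2) unfolding projective_def
proof (induction rule: rtrancl_induct)
  case base
  have "similar \<phi> \<mu>" if "\<mu> \<in> Cm A" "((\<phi>, cover A \<phi>), (\<mu>, cover A \<mu>)) \<in> transposes_up A" for \<mu>
    by (rule similar_of_common_transpose[OF \<phi> that(1) transposes_up_cover_refl[OF A \<phi>] that(2)])
  with prime_interval_cover[OF A \<phi>] show ?case by blast
next
  case (step I J)
  obtain \<alpha> \<beta> \<gamma> \<delta> where I: "I = (\<alpha>, \<beta>)" and J: "J = (\<gamma>, \<delta>)"
    by (cases I, cases J)
  from step(2) consider "(I, J) \<in> transposes_up A" | "(J, I) \<in> transposes_up A" by blast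
  then show ?case
  proof cases
    case 1
    note tr = 1[unfolded I J]
    have "prime_interval A (\<gamma>, \<delta>)"
      using prime_interval_up[OF A modular tr] step.IH I by blast
    moreover have "similar \<phi> \<mu>"
      if "\<mu> \<in> Cm A" "((\<gamma>, \<delta>), (\<mu>, cover A \<mu>)) \<in> transposes_up A" for \<mu>
      using step.IH that(1) transposes_up_trans[OF A tr that(2)] I by blast
    ultimately show ?thesis
      unfolding J by blast
  next
    case 2
    note tr = 2[unfolded I J]
    obtain \<nu> where \<nu>: "\<nu> \<in> Cm A" and tr\<nu>: "((\<alpha>, \<beta>), (\<nu>, cover A \<nu>)) \<in> transposes_up A"
      using prime_interval_transposes_to_cover[OF A] step.IH I by blast
    have "similar \<phi> \<nu>"
      using step.IH \<nu> tr\<nu> I by blast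
    moreover have "similar \<nu> \<mu>"
      if "\<mu> \<in> Cm A" "((\<gamma>, \<delta>), (\<mu>, cover A \<mu>)) \<in> transposes_up A" for \<mu>
      by (rule similar_of_common_transpose[OF \<nu> that(1) transposes_up_trans[OF A tr tr\<nu>] that(2)])
    moreover have "prime_interval A (\<gamma>, \<delta>)"
      using prime_interval_down[OF A modular tr] step.IH I by blast
    ultimately show ?thesis
      unfolding J similar_def by auto
  qed
qed

lemma Cm_sim_similar:
  assumes "(\<phi>, \<psi>) \<in> Cm_sim A"
  shows "similar \<phi> \<psi>"
proof -
  have "\<phi> \<in> Cm A" "\<psi> \<in> Cm A" "((\<phi>, cover A \<phi>), (\<psi>, cover A \<psi>)) \<in> projective A"
    using assms by (auto simp: Cm_sim_def)
  then show ?thesis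
    using projective_similar transposes_up_cover_refl[OF A] by blast
qed

section \<open>The Boolean group of a projectivity class\<close>

lemma bullet_iff:
  assumes "\<eta> \<in> Cm A"
  shows "(x, y) \<in> bullet A \<eta> \<phi> \<psi> \<longleftrightarrow> (x, y) \<in> cover A \<eta> \<and> ((x, y) \<in> \<phi> \<longleftrightarrow> (x, y) \<in> \<psi>)"
  using Con_carrier[OF cover_Con[OF assms]] by (auto simp: bullet_def)

text \<open>Transitivity is additivity modulo \<open>2\<close>. For compatibility, consider a pair separated by both
  \<open>\<phi>\<close> and \<open>\<psi>\<close>: by similarity a translation puts its image into both or into neither.\<close>

lemma bullet_Con:
  assumes \<phi>: "\<phi> \<in> Cm A" and \<psi>: "\<psi> \<in> Cm A" and sim: "similar \<phi> \<psi>"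
  shows "bullet A \<phi> \<phi> \<psi> \<in> Con A"
proof (rule ConI_translations[OF A])
  let ?K = "cover A \<phi>"
  note K = cover_Con[OF \<phi>] and C\<phi> = Cm_Con[OF \<phi>] and C\<psi> = Cm_Con[OF \<psi>]
  have K\<psi>: "cover A \<psi> = ?K"
    using sim by (simp add: similar_def)
  show "equiv (carrier A) (bullet A \<phi> \<phi> \<psi>)"
  proof (rule equivI)
    show "bullet A \<phi> \<phi> \<psi> \<subseteq> carrier A \<times> carrier A"
      using Con_carrier[OF K] by (auto simp: bullet_def)
    show "refl_on (carrier A) (bullet A \<phi> \<phi> \<psi>)"
      by (auto simp: refl_on_def bullet_iff[OF \<phi>] intro: Con_refl[OF K] Con_refl[OF C\<phi>] Con_refl[OF C\<psi>])
    show "sym (bullet A \<phi> \<phi> \<psi>)"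
      by (auto simp: sym_def bullet_iff[OF \<phi>] intro: Con_sym[OF K] Con_sym[OF C\<phi>] Con_sym[OF C\<psi>])
    show "trans (bullet A \<phi> \<phi> \<psi>)"
    proof (rule transI)
      fix x y z
      assume xy: "(x, y) \<in> bullet A \<phi> \<phi> \<psi>" and yz: "(y, z) \<in> bullet A \<phi> \<phi> \<psi>"
      then have k: "(x, y) \<in> ?K" "(y, z) \<in> ?K"
        by (simp_all add: bullet_iff[OF \<phi>])
      show "(x, z) \<in> bullet A \<phi> \<phi> \<psi>"
        using xy yz cover_parity[OF \<phi> k] cover_parity[OF \<psi> k[folded K\<psi>]] Con_trans[OF K k]
        by (simp add: bullet_iff[OF \<phi>])
    qed
  qed
  fix s x y
  assume s: "s \<in> elementary_translations A" and xy: "(x, y) \<in> bullet A \<phi> \<phi> \<psi>"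
  then have k: "(x, y) \<in> ?K" and iff: "(x, y) \<in> \<phi> \<longleftrightarrow> (x, y) \<in> \<psi>"
    by (simp_all add: bullet_iff[OF \<phi>])
  have "(s x, s y) \<in> \<phi> \<longleftrightarrow> (s x, s y) \<in> \<psi>"
  proof (cases "(x, y) \<in> \<phi>")
    case True
    with iff show ?thesis
      using Con_translation[OF C\<phi> s] Con_translation[OF C\<psi> s] by blast
  next
    case False
    then show ?thesis
      using collapses_iff[OF \<phi> s k False] collapses_iff[OF \<psi> s k[folded K\<psi>]] iff sim s
      by (simp add: similar_def)
  qed
  with Con_translation[OF K s k] show "(s x, s y) \<in> bullet A \<phi> \<phi> \<psi>"
    by (simp add: bullet_iff[OF \<phi>])
qed

text \<open>The congruences \<open>\<phi>\<close>, \<open>\<psi>\<close> and \<open>\<chi> = \<phi> \<bullet> \<psi>\<close> are the coatoms of a sublattice \<open>M\<^sub>3\<close> with top \<open>\<phi>\<^sup>+\<close> and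
  bottom \<open>\<phi> \<inter> \<psi>\<close>, so \<open>I[\<phi>, \<phi>\<^sup>+]\<close> and \<open>I[\<chi>, \<phi>\<^sup>+]\<close> are projective via \<open>I[\<phi> \<inter> \<psi>, \<psi>]\<close>. The latter
  transposes up to \<open>I[\<mu>, \<mu>\<^sup>+]\<close> for some completely meet irreducible \<open>\<mu>\<close>, and similarity of \<open>\<mu>\<close> and \<open>\<phi>\<close>
  gives \<open>\<mu>\<^sup>+ = \<phi>\<^sup>+\<close>. Hence \<open>\<mu> = \<phi>\<^sup>+ \<inter> \<mu> = \<chi>\<close>.\<close>

lemma bullet_Cm_sim:
  assumes sim: "(\<phi>, \<psi>) \<in> Cm_sim A" and neq: "\<phi> \<noteq> \<psi>"
  shows "(\<phi>, bullet A \<phi> \<phi> \<psi>) \<in> Cm_sim A"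
proof -
  let ?K = "cover A \<phi>" and ?\<chi> = "bullet A \<phi> \<phi> \<psi>"
  have \<phi>: "\<phi> \<in> Cm A" and \<psi>: "\<psi> \<in> Cm A"
    using sim by (auto simp: Cm_sim_def)
  note similar = Cm_sim_similar[OF sim]
  have K\<psi>: "cover A \<psi> = ?K"
    using similar by (simp add: similar_def)
  note K = cover_Con[OF \<phi>] and C\<phi> = Cm_Con[OF \<phi>] and C\<psi> = Cm_Con[OF \<psi>]
  note \<chi> = bullet_Con[OF \<phi> \<psi> similar] and iff = bullet_iff[OF \<phi>]
  have \<phi>K: "\<phi> \<subset> ?K" and \<psi>K: "\<psi> \<subset> ?K"
    using cover_greater[OF \<phi>] cover_greater[OF \<psi>] K\<psi> by auto
  have nle1: "\<not> \<phi> \<subseteq> \<psi>"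
    using cover_least[OF \<phi> C\<psi>] neq \<psi>K by blast
  have nle2: "\<not> \<psi> \<subseteq> \<phi>"
    using cover_least[OF \<psi> C\<phi>] neq \<phi>K K\<psi> by blast
  (* d and d' lie in different halves for \<phi> and for \<psi>, so (d, d') is in \<chi> but not in \<psi>. *)
  obtain d where d: "(e, d) \<in> \<phi>" "(e, d) \<notin> \<psi>"
    using regular_witness[OF C\<phi> C\<psi> nle1] by blast
  obtain d' where d': "(e, d') \<in> \<psi>" "(e, d') \<notin> \<phi>"
    using regular_witness[OF C\<psi> C\<phi> nle2] by blast
  have dd': "(d, d') \<in> ?K"
    using d(1) d'(1) \<phi>K \<psi>K Con_sym[OF K] Con_trans[OF K] by blast
  then have "(d, d') \<notin> \<phi>" and dd'\<psi>: "(d, d') \<notin> \<psi>"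
    using cover_iff[OF \<phi> dd'] cover_iff[OF \<psi> dd'[folded K\<psi>]] d d' by auto
  then have dd'\<chi>: "(d, d') \<in> ?\<chi>"
    using dd' by (simp add: iff)
  have \<chi>K: "?\<chi> \<subseteq> ?K"
    by (auto simp: iff)
  have tr\<phi>: "((\<phi> \<inter> \<psi>, \<psi>), (\<phi>, ?K)) \<in> transposes_up A"
  proof -
    have "?K \<subseteq> Con_join A \<psi> \<phi>"
      using in_join(2,3)[OF C\<psi> C\<phi>] nle2 by (intro cover_least[OF \<phi> in_join(1)[OF C\<psi> C\<phi>]]) auto
    moreover have "Con_join A \<psi> \<phi> \<subseteq> ?K"
      using \<phi>K \<psi>K by (intro in_join(4)[OF C\<psi> C\<phi> K]) auto
    ultimately show ?thesis
      unfolding transposes_up_iff using C\<phi> C\<psi> K Con_Int[OF A C\<phi> C\<psi>] \<phi>K by auto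
  qed
  have tr\<chi>: "((\<phi> \<inter> \<psi>, \<psi>), (?\<chi>, ?K)) \<in> transposes_up A"
  proof -
    have "cover A \<psi> \<subseteq> Con_join A \<psi> ?\<chi>"
      using in_join(2,3)[OF C\<psi> \<chi>] dd'\<psi> dd'\<chi>
      by (intro cover_least[OF \<psi> in_join(1)[OF C\<psi> \<chi>]]) auto
    moreover have "Con_join A \<psi> ?\<chi> \<subseteq> ?K"
      using \<chi>K \<psi>K by (intro in_join(4)[OF C\<psi> \<chi> K]) auto
    moreover have "\<psi> \<inter> ?\<chi> = \<phi> \<inter> \<psi>"
      using \<psi>K by (auto simp: iff)
    ultimately show ?thesis
      unfolding transposes_up_iff using C\<phi> C\<psi> \<chi> K Con_Int[OF A C\<phi> C\<psi>] \<chi>K K\<psi> by auto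
  qed
  have proj: "((\<phi>, ?K), (?\<chi>, ?K)) \<in> projective A"
    unfolding projective_def using tr\<phi> tr\<chi> by (blast intro: rtrancl_trans)
  note P = projective_similar[OF \<phi> proj]
  obtain \<mu> where \<mu>: "\<mu> \<in> Cm A" and tr\<mu>: "((?\<chi>, ?K), (\<mu>, cover A \<mu>)) \<in> transposes_up A"
    using prime_interval_transposes_to_cover[OF A] P by blast
  have "cover A \<mu> = ?K"
    using P \<mu> tr\<mu> unfolding similar_def by metis
  then have "\<mu> \<subset> ?K"
    using cover_greater[OF \<mu>] by simp
  moreover have "?K \<inter> \<mu> = ?\<chi>"
    using tr\<mu> unfolding transposes_up_iff by simp
  ultimately have "\<mu> = ?\<chi>"
    by blast
  with \<mu> \<open>cover A \<mu> = ?K\<close> \<phi> proj show ?thesis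
    by (simp add: Cm_sim_def)
qed

text \<open>Inside \<open>\<eta>\<^sup>+\<close>, a pair belongs to \<open>\<phi> \<bullet> \<psi>\<close> if it belongs to both or to neither of \<open>\<phi>\<close> and \<open>\<psi>\<close>, so
  the group laws hold pair by pair; the substance is closure.\<close>

lemma group_bar_group:
  assumes U: "U \<in> Cm A // Cm_sim A" and \<eta>: "\<eta> \<in> U"
  shows "group (bar_group A \<eta> U)"
    and "\<And>\<phi>. \<phi> \<in> bar A \<eta> U \<Longrightarrow> inv\<^bsub>bar_group A \<eta> U\<^esub> \<phi> = \<phi>"
proof -
  let ?G = "bar_group A \<eta> U" and ?K = "cover A \<eta>"
  have \<eta>Cm: "\<eta> \<in> Cm A"
    using in_quotient_imp_subset[OF equiv_Cm_sim U] \<eta> by blast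
  note iff = bullet_iff[OF \<eta>Cm]
  have sim: "(\<phi>, \<psi>) \<in> Cm_sim A" if "\<phi> \<in> U" "\<psi> \<in> U" for \<phi> \<psi>
    by (rule in_quotient_imp_in_rel[OF equiv_Cm_sim U]) (use that in auto)
  have K: "cover A \<phi> = ?K" if "\<phi> \<in> U" for \<phi>
    using Cm_sim_similar[OF sim[OF that \<eta>]] by (simp add: similar_def)
  have le: "\<phi> \<subseteq> ?K" if "\<phi> \<in> bar A \<eta> U" for \<phi>
    using that K cover_greater in_quotient_imp_subset[OF equiv_Cm_sim U] by (auto simp: bar_def)
  have unit: "bullet A \<eta> ?K \<phi> = \<phi>" "bullet A \<eta> \<phi> ?K = \<phi>" if "\<phi> \<subseteq> ?K" for \<phi>
    using that by (auto simp: iff)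
  have self: "bullet A \<eta> \<phi> \<phi> = ?K" for \<phi>
    by (auto simp: iff)
  have closed: "bullet A \<eta> \<phi> \<psi> \<in> bar A \<eta> U" if mem: "\<phi> \<in> bar A \<eta> U" "\<psi> \<in> bar A \<eta> U" for \<phi> \<psi>
  proof -
    consider "\<phi> = ?K" | "\<psi> = ?K" | "\<phi> = \<psi>" | "\<phi> \<in> U" "\<psi> \<in> U" "\<phi> \<noteq> \<psi>"
      using mem by (auto simp: bar_def)
    then show ?thesis
    proof cases
      case 4
      have "bullet A \<eta> \<phi> \<psi> = bullet A \<phi> \<phi> \<psi>"
        by (simp add: bullet_def K[OF 4(1)])
      then have "(\<phi>, bullet A \<eta> \<phi> \<psi>) \<in> Cm_sim A"
        using bullet_Cm_sim[OF sim[OF 4(1,2)] 4(3)] by simp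
      then show ?thesis
        using in_quotient_imp_closed[OF equiv_Cm_sim U 4(1)] by (simp add: bar_def)
    qed (use mem unit le self in \<open>auto simp: bar_def\<close>)
  qed
  have sel: "carrier ?G = bar A \<eta> U" "\<phi> \<otimes>\<^bsub>?G\<^esub> \<psi> = bullet A \<eta> \<phi> \<psi>" "\<one>\<^bsub>?G\<^esub> = ?K" for \<phi> \<psi>
    by (simp_all add: bar_group_def)
  show G: "group ?G"
  proof (rule groupI; unfold sel)
    show "?K \<in> bar A \<eta> U"
      by (simp add: bar_def)
    show "bullet A \<eta> (bullet A \<eta> \<phi> \<psi>) \<chi> = bullet A \<eta> \<phi> (bullet A \<eta> \<psi> \<chi>)" for \<phi> \<psi> \<chi>
      by (auto simp: iff)
    show "\<exists>\<psi>\<in>bar A \<eta> U. bullet A \<eta> \<psi> \<phi> = ?K" if "\<phi> \<in> bar A \<eta> U" for \<phi>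
      using that self by blast
  qed (use closed unit le in auto)
  show "inv\<^bsub>?G\<^esub> \<phi> = \<phi>" if "\<phi> \<in> bar A \<eta> U" for \<phi>
    by (rule group.inv_equality[OF G]) (simp_all add: sel that self)
qed

text \<open>The congruence \<open>\<eta>\<^sup>+\<close> is the meet of the completely meet irreducible congruences above it.\<close>

lemma upper_separates:
  assumes \<eta>: "\<eta> \<in> Cm A" and ab: "a \<in> carrier A" "b \<in> carrier A"
    and upper: "upper A \<eta> \<subseteq> M A (Cg A a b)"
  shows "(a, b) \<in> cover A \<eta>"
proof (rule ccontr)
  assume "(a, b) \<notin> cover A \<eta>"
  then obtain \<mu> where \<mu>: "\<mu> \<in> Cm A" "cover A \<eta> \<subseteq> \<mu>" "(a, b) \<notin> \<mu>"
    using Cm_separates[OF cover_Con[OF \<eta>] _ ab] by blast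
  then have "Cg A a b \<subseteq> \<mu>"
    using upper by (auto simp: upper_def M_def)
  with \<mu>(3) Cg_in_Con(2)[OF A ab] show False by blast
qed

text \<open>Membership of \<open>(a, b)\<close> is a homomorphism from the group to the group of two elements, and \<open>H\<close>
  is its kernel. A subgroup that contains \<open>H\<close> and some \<open>\<kappa>\<close> outside \<open>H\<close> contains every other \<open>\<phi>\<close>
  outside \<open>H\<close>, since \<open>\<phi> \<bullet> \<kappa>\<close> lies in \<open>H\<close>.\<close>

lemma hyperplane_of_pair:
  assumes U: "U \<in> Cm A // Cm_sim A" and \<eta>: "\<eta> \<in> U" and ab: "(a, b) \<in> cover A \<eta>"
    and proper: "H \<noteq> bar A \<eta> U" and H: "H = {\<phi> \<in> bar A \<eta> U. (a, b) \<in> \<phi>}"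
  shows "hyperplane H (bar_group A \<eta> U)"
proof -
  let ?G = "bar_group A \<eta> U"
  have \<eta>Cm: "\<eta> \<in> Cm A"
    using in_quotient_imp_subset[OF equiv_Cm_sim U] \<eta> by blast
  note iff = bullet_iff[OF \<eta>Cm] and G = group_bar_group[OF U \<eta>]
  have sel: "carrier ?G = bar A \<eta> U" "\<phi> \<otimes>\<^bsub>?G\<^esub> \<psi> = bullet A \<eta> \<phi> \<psi>" "\<one>\<^bsub>?G\<^esub> = cover A \<eta>" for \<phi> \<psi>
    by (simp_all add: bar_group_def)
  have closed: "bullet A \<eta> \<phi> \<psi> \<in> bar A \<eta> U" if "\<phi> \<in> bar A \<eta> U" "\<psi> \<in> bar A \<eta> U" for \<phi> \<psi>
    using monoid.m_closed[OF group.is_monoid[OF G(1)]] that by (simp add: sel)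
  have one: "cover A \<eta> \<in> H"
    using ab by (simp add: H bar_def)
  have sub: "subgroup H ?G"
  proof (rule subgroup.intro; (unfold sel)?)
    show "H \<subseteq> bar A \<eta> U" "cover A \<eta> \<in> H"
      using one by (auto simp: H)
    show "inv\<^bsub>?G\<^esub> \<phi> \<in> H" if "\<phi> \<in> H" for \<phi>
      using that G(2) by (simp add: H)
    show "bullet A \<eta> \<phi> \<psi> \<in> H" if "\<phi> \<in> H" "\<psi> \<in> H" for \<phi> \<psi>
      using that closed ab by (simp add: H iff)
  qed
  have "K = bar A \<eta> U" if K: "subgroup K ?G" and HK: "H \<subseteq> K" and neq: "K \<noteq> H" for K
  proof
    show KG: "K \<subseteq> bar A \<eta> U"
      using subgroup.subset[OF K] by (simp add: sel)
    obtain \<kappa> where \<kappa>: "\<kappa> \<in> K" "(a, b) \<notin> \<kappa>"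
      using HK neq KG by (auto simp: H)
    show "bar A \<eta> U \<subseteq> K"
    proof
      fix \<phi> assume \<phi>: "\<phi> \<in> bar A \<eta> U"
      show "\<phi> \<in> K"
      proof (cases "(a, b) \<in> \<phi>")
        case True
        with \<phi> HK show ?thesis by (auto simp: H)
      next
        case False
        then have "bullet A \<eta> \<phi> \<kappa> \<in> H"
          using \<phi> \<kappa> KG closed ab by (auto simp: H iff)
        then have "bullet A \<eta> (bullet A \<eta> \<phi> \<kappa>) \<kappa> \<in> K"
          using subgroup.m_closed[OF K _ \<kappa>(1), of "bullet A \<eta> \<phi> \<kappa>"] HK by (auto simp: sel)
        moreover have "bullet A \<eta> (bullet A \<eta> \<phi> \<kappa>) \<kappa> = bullet A \<eta> \<phi> (cover A \<eta>)"
          by (auto simp: iff)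
        moreover have "bullet A \<eta> \<phi> (cover A \<eta>) = \<phi>"
          using monoid.r_one[OF group.is_monoid[OF G(1)]] \<phi> by (simp add: sel)
        ultimately show ?thesis by simp
      qed
    qed
  qed
  then show ?thesis
    unfolding hyperplane_def sel using sub proper by blast
qed

lemma hereditary_M_Cg:
  assumes ab: "a \<in> carrier A" "b \<in> carrier A"
  shows "hereditary A (M A (Cg A a b))"
  unfolding hereditary_def
proof (intro conjI ballI impI)
  let ?Z = "M A (Cg A a b)"
  show "?Z \<subseteq> Cm A"
    by (auto simp: M_def)
  show "\<psi> \<in> ?Z" if "\<phi> \<in> ?Z" "\<psi> \<in> Cm A" "\<phi> \<subseteq> \<psi>" for \<phi> \<psi>
    using that by (auto simp: M_def)
  fix U \<eta>
  assume U: "U \<in> Cm A // Cm_sim A" and \<eta>: "\<eta> \<in> U" and upper: "upper A \<eta> \<subseteq> ?Z"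
  have UCm: "U \<subseteq> Cm A"
    by (rule in_quotient_imp_subset[OF equiv_Cm_sim U])
  have cover: "(a, b) \<in> cover A \<eta>"
    using UCm \<eta> by (intro upper_separates[OF _ ab upper]) auto
  have "\<mu> \<in> ?Z \<longleftrightarrow> (a, b) \<in> \<mu>" if "\<mu> \<in> Cm A" for \<mu>
    using that Cg_in_Con(2,3)[OF A ab] Cm_Con[OF that] by (auto simp: M_def)
  then have "bar A \<eta> (?Z \<inter> U) = {\<phi> \<in> bar A \<eta> U. (a, b) \<in> \<phi>}"
    using cover UCm by (auto simp: bar_def)
  then show "bar A \<eta> (?Z \<inter> U) = bar A \<eta> U \<or>
      hyperplane (bar A \<eta> (?Z \<inter> U)) (bar_group A \<eta> U)"
    using hyperplane_of_pair[OF U \<eta> cover] by blast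
qed

end

theorem proposition27:
  fixes A :: "('a, 'f) ualg" and t :: "('f, nat) trm" and a b :: 'a
  assumes "strongly_fregean A t"
    and "a \<in> carrier A" and "b \<in> carrier A"
  shows "M A (Cg A a b) \<in> hereditary_sets A"
proof -
  interpret strongly_fregean_algebra A t
    by (rule strongly_fregean_algebra.intro[OF assms(1)])
  show ?thesis
    using hereditary_M_Cg[OF assms(2,3)] by (simp add: hereditary_sets_def)
qed

end
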